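(* Let $d,m\ge 1$ be integers, $n=d+m$, let $A=\begin{pmatrix}\bm{\beta}\\ A'\end{pmatrix}\in\mathbb{R}^{(d+1)\times m}$ with $\bm{\beta}\in\mathbb{R}^m$ and $A'\in\mathbb{R}^{d\times m}$, and let $\mathcal{L}=\{(\bm{x},\widetilde{\bm{x}}A)\mid \bm{x}\in\mathbb{R}^d\}\subset\mathbb{R}^n$, where $\widetilde{\bm{x}}=(1,\bm{x})$. Let $\mathcal{Q}$ be an infinite subset of $\mathbb{N}$ with $\nu(\mathcal{Q})=\nu$. Suppose that $\omega(A')=\omega<\frac{n}{\nu}$, and let $s$ be a real number with $$\frac{\omega(d+\nu)-m}{\omega+1}<s\le d.$$ Then for any (not necessarily decreasing) function $\psi:\mathcal{Q}\to\mathbb{R}_{\ge0}$ such that $$\sum_{q\in\mathcal{Q}}\psi(q)^{m+s}q^{d-s}<\infty,$$ and for any $\bm{\theta}\in\mathbb{R}^n$, we have $$\mathcal{H}^s(\mathcal{S}_n(\psi,\bm{\theta})\cap\mathcal{L})=0.$$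
   Context: Vectors are row vectors; $|\cdot|$ is the supremum norm; $\|\bm{y}\|$ is the sup-norm distance of $\bm{y}$ to the nearest integer vector (also for column vectors). $\mathcal{H}^s$ is $s$-dimensional Hausdorff measure. The diophantine exponent $\omega(B)$ of a real matrix $B$ with $m$ columns is the supremum (possibly $\infty$) of all $\omega\in\mathbb{R}$ such that $\|B\bm{q}^{\mathrm T}\|<|\bm{q}|^{-\omega}$ holds for infinitely many $\bm{q}\in\mathbb{Z}^m$. For infinite $\mathcal{Q}\subseteq\mathbb{N}$, $\nu(\mathcal{Q}):=\inf\{\nu\in\mathbb{R}:\sum_{q\in\mathcal{Q}}q^{-\nu}<\infty\}\in[0,1]$. When $\nu=0$, the condition $\omega<n/\nu$ means $\omega<\infty$. For $\psi:\mathcal{Q}\to\mathbb{R}_{\ge0}$ (regarded as an approximation function supported in $\mathcal{Q}$), $\mathcal{S}_n(\psi,\bm{\theta})=\{\bm{y}\in\mathbb{R}^n:\|q\bm{y}-\bm{\theta}\|<\psi(q)\text{ for infinitely many }q\in\mathcal{Q}\}$. *)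

theory Defs
  imports "HOL-Analysis.Analysis"
begin

definition int_vectors :: "(real^'n) set" where
  "int_vectors = {z. \<forall>i. z $ i \<in> \<int>}"

(* infnorm is the library's supremum norm. *)
definition dist_int :: "real^'n \<Rightarrow> real" where
  "dist_int y = (INF z\<in>int_vectors. infnorm (y - z))"

definition dioph_exponent :: "real^'m^'k \<Rightarrow> ereal" where
  "dioph_exponent B =
     Sup {ereal \<omega> | \<omega>. infinite {q \<in> int_vectors. dist_int (B *v q) < infnorm q powr (- \<omega>)}}"

(* For an infinite set Q of positive integers the set of admissible exponents contains every
   real greater than 1 and no nonpositive real, so the real infimum is a genuine one. *)
definition conv_exponent :: "nat set \<Rightarrow> real" where
  "conv_exponent Q = Inf {\<nu>::real. (\<lambda>q. real q powr (- \<nu>)) summable_on Q}"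

(* Inhomogeneous simultaneously psi-approximable points, with denominators restricted to Q.
   Only the values of psi on Q matter. *)
definition approximable_set :: "nat set \<Rightarrow> (nat \<Rightarrow> real) \<Rightarrow> real^'n \<Rightarrow> (real^'n) set" where
  "approximable_set Q \<psi> \<theta> = {y. infinite {q \<in> Q. dist_int (real q *\<^sub>R y - \<theta>) < \<psi> q}}"

(* The index type 'a + 'b puts the coordinates of the first vector before those of the second.
   For a vector of row vectors this stacks the rows of two matrices. *)
definition vec_append :: "'a^'p \<Rightarrow> 'a^'q \<Rightarrow> 'a^('p + 'q)" where
  "vec_append x y = (\<chi> i. case i of Inl j \<Rightarrow> x $ j | Inr j \<Rightarrow> y $ j)"

(* The row vector (1, x). *)
definition tilde :: "real^'d \<Rightarrow> real^(1 + 'd)" where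
  "tilde x = vec_append (vec 1) x"

definition affine_graph :: "real^'m^(1 + 'd::finite) \<Rightarrow> (real^('d + 'm)) set" where
  "affine_graph A = {vec_append x (tilde x v* A) | x. True}"

(* The s-th power of the diameter, with the conventions 0^0 = 1 for nonempty sets (so that
   0-dimensional Hausdorff measure counts points) and the empty set contributing 0. *)
definition diam_power :: "real \<Rightarrow> 'a::metric_space set \<Rightarrow> ennreal" where
  "diam_power s U =
     (if U = {} then 0 else if s = 0 then 1 else ennreal (diameter U powr s))"

definition hausdorff_content :: "real \<Rightarrow> real \<Rightarrow> 'a::metric_space set \<Rightarrow> ennreal" where
  "hausdorff_content s \<delta> E =
     (INF U \<in> {U :: nat \<Rightarrow> 'a set. E \<subseteq> (\<Union>i. U i) \<and> (\<forall>i. bounded (U i) \<and> diameter (U i) \<le> \<delta>)}.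
        \<Sum>i. diam_power s (U i))"

(* Meaningful for s \<ge> 0. Diameters are taken in the metric of the type, which on real^'n is the
   Euclidean one; the supremum norm gives the same measure up to bounded factors, hence the same
   null sets. *)
definition hausdorff_measure :: "real \<Rightarrow> 'a::metric_space set \<Rightarrow> ennreal" where
  "hausdorff_measure s E = (SUP \<delta> \<in> {0<..}. hausdorff_content s \<delta> E)"

end

theory Submission
  imports Defs
begin

text \<open>
  Write \<open>n = d + m\<close>. A point of the affine subspace has the form \<open>y = (x, \<beta> + x A')\<close>. If
  \<open>q y - \<theta>\<close> is within \<open>\<psi> q\<close> of an integer vector, and \<open>p\<close> denotes the first \<open>d\<close> coordinates of that
  vector, then \<open>x\<close> is within \<open>\<psi> q / q\<close> of \<open>(p + \<theta>) / q\<close> (with \<open>\<theta>\<close> cut to its first \<open>d\<close> coordinates),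
  and \<open>p A'\<close> is within \<open>O(\<psi> q)\<close>, modulo one, of a target that depends on \<open>q\<close> only. So for bounded \<open>x\<close>
  the approximable points are covered, for each \<open>q\<close>, by balls of radius \<open>O(\<psi> q / q)\<close>, one for each
  integer vector \<open>p\<close> of size \<open>O(q)\<close> with \<open>p A'\<close> near the target
  (\<open>approximable_near_rational_center\<close>). The theorem follows from a Borel-Cantelli argument
  (\<open>hausdorff_cantelli\<close>) once the number of these \<open>p\<close> is known to be \<open>O(q^d r^m)\<close>, the order that
  equidistribution predicts, for tolerances \<open>r\<close> that are not too small.

  The exponent of \<open>A'\<close> controls \<open>A' h\<close> for column vectors \<open>h\<close>, whereas the count concerns the
  row vectors \<open>p A'\<close>. The bridge is a large sieve inequality. For \<open>\<omega>' > \<omega>\<close> the distance of \<open>A' h\<close> to the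
  integers is at least \<open>c |h| powr (-\<omega>')\<close> for all nonzero \<open>h\<close> (\<open>dist_int_lower_bound\<close>). Hence the
  points \<open>A' h\<close> with \<open>h \<in> [0, K)\<^sup>m\<close> are \<open>1 / q\<close>-separated modulo one as long as \<open>K powr \<omega>' \<le> c q\<close>.
  For separated frequencies the exponential sums \<open>\<Sum>h. e(h \<cdot> (p A' - \<gamma>))\<close> have mean square \<open>O(K^m)\<close>
  over \<open>p\<close> in a cube of side of order \<open>q\<close> (\<open>dual_large_sieve\<close>), while each \<open>p\<close> with \<open>p A'\<close> within
  a constant times \<open>1 / K\<close> of \<open>\<gamma>\<close> contributes \<open>K^(2 m)\<close> up to a constant. Dividing gives
  \<open>O(q^d K^-m)\<close> such points (\<open>card_near_points_le\<close>), which is the claim with \<open>r\<close> of order \<open>1 / K\<close>.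

  This count is available for \<open>r \<ge> (c q) powr (-1 / \<omega>')\<close>. When \<open>\<psi> q\<close> is smaller, it is
  replaced by this threshold. The contribution of the threshold to the Hausdorff sum is a constant
  times the sum over \<open>Q\<close> of \<open>q powr (d - s - (m + s) / \<omega>')\<close>, which converges when
  \<open>(m + s) / \<omega>' - (d - s) > \<nu>\<close>. For \<open>\<omega>'\<close> close to \<open>\<omega>\<close> this is the lower bound imposed on \<open>s\<close>.
\<close>

section \<open>Exponential sums over intervals\<close>

definition unit_char :: "real \<Rightarrow> complex" where
  "unit_char x = cis (2 * pi * x)"

lemma unit_char_add: "unit_char (x + y) = unit_char x * unit_char y"
  by (simp add: unit_char_def cis_mult distrib_left)

lemma cnj_unit_char: "cnj (unit_char x) = unit_char (- x)"
  by (simp add: unit_char_def cis_cnj)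

lemma norm_unit_char [simp]: "cmod (unit_char x) = 1"
  by (simp add: unit_char_def)

lemma unit_char_of_int [simp]: "unit_char (of_int k) = 1"
  by (simp add: unit_char_def)

lemma unit_char_sum: "finite I \<Longrightarrow> unit_char (\<Sum>i\<in>I. f i) = (\<Prod>i\<in>I. unit_char (f i))"
  by (induction I rule: finite_induct) (auto simp: unit_char_add unit_char_def[of 0])

lemma unit_char_power: "unit_char x ^ n = unit_char (real n * x)"
  unfolding unit_char_def Complex.DeMoivre by (simp add: algebra_simps)

lemma Re_unit_char_ge_half:
  assumes "\<bar>x - of_int k\<bar> \<le> 1 / 6"
  shows "1 / 2 \<le> Re (unit_char x)"
proof -
  have "unit_char x = unit_char (of_int k + (x - of_int k))" by simp
  also have "\<dots> = unit_char (x - of_int k)" by (simp only: unit_char_add unit_char_of_int) simp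
  finally have "Re (unit_char x) = cos \<bar>2 * pi * (x - of_int k)\<bar>"
    by (simp add: unit_char_def)
  moreover have "\<bar>2 * pi * (x - of_int k)\<bar> \<le> pi / 3"
  proof -
    have "2 * pi * \<bar>x - of_int k\<bar> \<le> 2 * pi * (1 / 6)"
      using assms pi_gt_zero by (intro mult_left_mono) auto
    then show ?thesis by (simp add: abs_mult)
  qed
  ultimately show ?thesis
    using cos_monotone_0_pi_le[of "\<bar>2 * pi * (x - of_int k)\<bar>" "pi / 3"] pi_gt_zero
    by (simp add: cos_60)
qed

text \<open>A weak form of Jordan's inequality suffices, because only the order of magnitude of the kernel
  matters.\<close>

lemma sin_ge_half:
  assumes "0 \<le> x" "x \<le> pi / 2"
  shows "x / 2 \<le> sin (x :: real)"
proof (cases "x \<le> pi / 3")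
  case True
  show ?thesis
  proof (cases "x = 0")
    case False
    then have "0 < x" using assms by simp
    then obtain z where z: "0 < z" "z < x" "sin x - sin 0 = (x - 0) * cos z"
      using MVT2[of 0 x sin cos] by (auto intro!: derivative_eq_intros)
    have "cos (pi / 3) \<le> cos z"
      using z True pi_gt_zero by (intro cos_monotone_0_pi_le) auto
    then have "x * (1 / 2) \<le> x * cos z" using \<open>0 < x\<close> by (intro mult_left_mono) (auto simp: cos_60)
    then show ?thesis using z by simp
  qed auto
next
  case False
  have "sin (pi / 3) \<le> sin x"
    using False assms pi_gt_zero by (intro sin_monotone_2pi_le) auto
  moreover have "1.7 \<le> sqrt 3" by (rule real_le_rsqrt) (simp add: power2_eq_square)
  moreover have "pi \<le> 3.2" using pi_approx by simp
  ultimately show ?thesis using assms by (simp add: sin_60)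
qed

lemma norm_unit_char_minus_one_ge:
  assumes "\<bar>t\<bar> \<le> 1 / 2"
  shows "2 * \<bar>t\<bar> \<le> cmod (unit_char t - 1)"
proof -
  have "(cmod (unit_char t - 1))\<^sup>2 = (cos (2 * (pi * t)) - 1)\<^sup>2 + (sin (2 * (pi * t)))\<^sup>2"
    by (simp add: unit_char_def cmod_power2 mult_ac)
  also have "\<dots> = (2 * sin (pi * t))\<^sup>2"
    using sin_cos_squared_add[of "pi * t"] unfolding cos_double sin_double
    by (simp add: power2_eq_square) algebra
  finally have eq: "cmod (unit_char t - 1) = \<bar>2 * sin (pi * t)\<bar>"
    by (metis abs_norm_cancel power2_eq_iff_nonneg abs_ge_zero power2_abs)
  have "\<bar>sin (pi * t)\<bar> = \<bar>sin (pi * \<bar>t\<bar>)\<bar>"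
    by (cases "t \<ge> 0") auto
  moreover have "pi * \<bar>t\<bar> / 2 \<le> sin (pi * \<bar>t\<bar>)"
    using assms pi_gt_zero by (intro sin_ge_half) (auto simp: field_simps)
  moreover have "2 * \<bar>t\<bar> \<le> pi * \<bar>t\<bar>"
    using pi_ge_two by (intro mult_right_mono) auto
  ultimately show ?thesis using eq by simp
qed

definition dirichlet_kernel :: "nat \<Rightarrow> real \<Rightarrow> complex" where
  "dirichlet_kernel M t = (\<Sum>k<M. unit_char (real k * t))"

lemma dirichlet_kernel_shift: "dirichlet_kernel M (t - of_int k) = dirichlet_kernel M t"
proof -
  have "unit_char (real j * (t - of_int k)) = unit_char (real j * t)" for j
  proof -
    have "real j * t = real j * (t - of_int k) + of_int (int j * k)"
      by (simp add: algebra_simps)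
    then show ?thesis by (simp only: unit_char_add unit_char_of_int) simp
  qed
  then show ?thesis by (simp add: dirichlet_kernel_def)
qed

text \<open>The trivial bound \<open>M\<close> near the origin and the geometric sum formula away from it combine
  to the decay \<open>1 / j\<^sup>2\<close> in the index \<open>j\<close> of the cell \<open>[j / M, (j + 1) / M)\<close> that contains
  \<open>t\<close>. The decay is summable over the cells, which is what makes a family of frequencies cost
  no more than a bounded number of them once each cell contains at most one.\<close>

lemma dirichlet_kernel_cell_bound:
  assumes "\<bar>t\<bar> \<le> 1 / 2"
  shows "(cmod (dirichlet_kernel M t))\<^sup>2 \<le> (real M)\<^sup>2 * (5 / (1 + (real_of_int \<lfloor>real M * t\<rfloor>)\<^sup>2))"
proof (cases "M = 0")
  case False
  define u j where "u = real M * t" and "j = real_of_int \<lfloor>real M * t\<rfloor>"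
  have triv: "cmod (dirichlet_kernel M t) \<le> real M"
    unfolding dirichlet_kernel_def by (rule order_trans[OF norm_sum]) simp
  have decay: "cmod (dirichlet_kernel M t) * \<bar>t\<bar> \<le> 1"
  proof -
    have "dirichlet_kernel M t * (unit_char t - 1) = unit_char t ^ M - 1"
      unfolding dirichlet_kernel_def unit_char_power[symmetric]
      by (simp add: power_diff_1_eq mult.commute)
    then have "cmod (dirichlet_kernel M t) * cmod (unit_char t - 1) = cmod (unit_char t ^ M - 1)"
      by (metis norm_mult)
    also have "\<dots> \<le> 2"
      by (rule order_trans[OF norm_triangle_ineq4]) (simp add: norm_power)
    finally have "cmod (dirichlet_kernel M t) * cmod (unit_char t - 1) \<le> 2" .
    moreover have "cmod (dirichlet_kernel M t) * (2 * \<bar>t\<bar>)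
        \<le> cmod (dirichlet_kernel M t) * cmod (unit_char t - 1)"
      by (intro mult_left_mono norm_unit_char_minus_one_ge assms) auto
    ultimately show ?thesis by simp
  qed
  have "\<bar>j\<bar> \<le> \<bar>u\<bar> + 1"
    unfolding u_def j_def by linarith
  then have "j\<^sup>2 \<le> (\<bar>u\<bar> + 1)\<^sup>2"
    by (metis abs_ge_zero abs_le_square_iff abs_of_nonneg add_nonneg_nonneg zero_le_one)
  also have "\<dots> \<le> 2 * u\<^sup>2 + 2"
    using zero_le_power2[of "\<bar>u\<bar> - 1"] by (simp add: power2_eq_square algebra_simps)
  finally have j: "1 + j\<^sup>2 \<le> 2 * u\<^sup>2 + 3" by simp
  have k2: "(cmod (dirichlet_kernel M t))\<^sup>2 \<le> (real M)\<^sup>2"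
    using triv by (intro power_mono) auto
  have "(cmod (dirichlet_kernel M t) * \<bar>t\<bar>)\<^sup>2 \<le> 1"
    using decay by (simp add: power_le_one)
  then have "(real M)\<^sup>2 * ((cmod (dirichlet_kernel M t))\<^sup>2 * t\<^sup>2) \<le> (real M)\<^sup>2 * 1"
    by (intro mult_left_mono) (auto simp: power_mult_distrib)
  then have k1: "(cmod (dirichlet_kernel M t))\<^sup>2 * u\<^sup>2 \<le> (real M)\<^sup>2"
    by (simp add: u_def power_mult_distrib mult_ac)
  have "(cmod (dirichlet_kernel M t))\<^sup>2 * (1 + j\<^sup>2) \<le> (cmod (dirichlet_kernel M t))\<^sup>2 * (2 * u\<^sup>2 + 3)"
    using j by (intro mult_left_mono) auto
  also have "\<dots> \<le> (real M)\<^sup>2 * 5"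
    using k1 k2 unfolding distrib_left by linarith
  finally show ?thesis
    unfolding j_def[symmetric]
    by (simp add: pos_le_divide_eq add_pos_nonneg)
qed (simp add: dirichlet_kernel_def)

definition kernel_constant :: real where
  "kernel_constant = (\<Sum>\<^sub>\<infinity>j::int. 5 / (1 + (real_of_int j)\<^sup>2))"

lemma cell_weights_summable: "(\<lambda>j::int. 5 / (1 + (real_of_int j)\<^sup>2)) summable_on UNIV"
proof -
  define f where "f n = 5 / (1 + (real n)\<^sup>2)" for n
  have "summable f"
  proof (rule summable_comparison_test')
    show "summable (\<lambda>n. 5 * inverse ((real n)\<^sup>2))"
      by (intro summable_mult inverse_power_summable) simp
    show "norm (f n) \<le> 5 * inverse ((real n)\<^sup>2)" if "n \<ge> 1" for n
      using that by (auto simp: f_def divide_inverse intro!: le_imp_inverse_le)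
  qed
  then have f: "f summable_on UNIV"
    by (intro norm_summable_imp_summable_on) (simp add: f_def[abs_def])
  have "(\<lambda>j::int. 5 / (1 + (real_of_int j)\<^sup>2)) summable_on {0..}"
    using f by (subst summable_on_reindex_bij_witness[where i = int and j = nat and T = UNIV and h = f])
      (auto simp: f_def)
  moreover have "(\<lambda>j::int. 5 / (1 + (real_of_int j)\<^sup>2)) summable_on {..0}"
    using f by (subst summable_on_reindex_bij_witness
        [where i = "\<lambda>n. - int n" and j = "\<lambda>j. nat (- j)" and T = UNIV and h = f]) (auto simp: f_def)
  ultimately have "(\<lambda>j::int. 5 / (1 + (real_of_int j)\<^sup>2)) summable_on ({0..} \<union> {..0})"
    by (rule summable_on_union)
  moreover have "{0..} \<union> {..0::int} = UNIV" by auto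
  ultimately show ?thesis by simp
qed

lemma cell_weight_sum_le:
  "finite J \<Longrightarrow> (\<Sum>j\<in>J. 5 / (1 + (real_of_int j)\<^sup>2)) \<le> kernel_constant"
  unfolding kernel_constant_def by (rule finite_sum_le_infsum[OF cell_weights_summable]) auto

section \<open>A large sieve bound for separated frequencies\<close>

definition index_box :: "nat \<Rightarrow> ('i \<Rightarrow> nat) set" where
  "index_box M = (UNIV \<rightarrow>\<^sub>E {..<M})"

lemma finite_index_box [simp]: "finite (index_box M :: ('i::finite \<Rightarrow> nat) set)"
  by (simp add: index_box_def finite_PiE)

lemma card_index_box: "card (index_box M :: ('i::finite \<Rightarrow> nat) set) = M ^ CARD('i)"
  by (simp add: index_box_def card_PiE)

lemma index_box_iff: "a \<in> index_box M \<longleftrightarrow> (\<forall>i. a i < M)"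
  by (auto simp: index_box_def PiE_def)

lemma sum_unit_char_index_box:
  fixes t :: "'d::finite \<Rightarrow> real"
  shows "(\<Sum>a\<in>index_box M. unit_char (\<Sum>i\<in>UNIV. real (a i) * t i)) = (\<Prod>i\<in>UNIV. dirichlet_kernel M (t i))"
  unfolding dirichlet_kernel_def index_box_def
  by (subst prod_sum_PiE) (auto simp: unit_char_sum)

text \<open>Points that are pairwise \<open>1 / M\<close>-separated modulo one lie in distinct cells of side \<open>1 / M\<close> of
  the torus, so the sum over the points is at most the sum over all cells, and the latter factors
  over the coordinates.\<close>

lemma separated_kernel_sum:
  fixes T :: "'h \<Rightarrow> 'd::finite \<Rightarrow> real"
  assumes H: "finite H" and M: "0 < M"
    and sep: "\<And>h h' z. h \<in> H \<Longrightarrow> h' \<in> H \<Longrightarrow> h \<noteq> h' \<Longrightarrow>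
      \<exists>i. 1 / real M \<le> \<bar>T h i - T h' i - real_of_int (z i)\<bar>"
  shows "(\<Sum>h\<in>H. \<Prod>i\<in>UNIV. (cmod (dirichlet_kernel M (T h i)))\<^sup>2) \<le> ((real M)\<^sup>2 * kernel_constant) ^ CARD('d)"
proof -
  \<comment> \<open>\<open>\<tau>\<close> is the representative modulo one in \<open>[-1/2, 1/2]\<close>.\<close>
  define \<tau> where "\<tau> h i = T h i - of_int (round (T h i))" for h i
  define cell where "cell h = (\<lambda>i. \<lfloor>real M * \<tau> h i\<rfloor>)" for h
  define w where "w j = (real M)\<^sup>2 * (5 / (1 + (real_of_int j)\<^sup>2))" for j
  define J where "J = (\<Union>h\<in>H. range (cell h))"
  have J: "finite J" unfolding J_def using H by auto
  have w0: "0 \<le> w j" for j by (simp add: w_def)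
  have inj: "inj_on cell H"
  proof (rule inj_onI, rule ccontr)
    fix h h' assume hh: "h \<in> H" "h' \<in> H" "cell h = cell h'" "h \<noteq> h'"
    obtain i where i: "1 / real M \<le> \<bar>T h i - T h' i - real_of_int (round (T h i) - round (T h' i))\<bar>"
      using sep[OF hh(1,2,4), of "\<lambda>i. round (T h i) - round (T h' i)"] by auto
    have "1 / real M \<le> \<bar>\<tau> h i - \<tau> h' i\<bar>"
      using i by (simp add: \<tau>_def algebra_simps)
    then have "1 \<le> real M * \<bar>\<tau> h i - \<tau> h' i\<bar>"
      using M by (simp add: field_simps)
    then have "1 \<le> \<bar>real M * \<tau> h i - real M * \<tau> h' i\<bar>"
      using M by (simp add: abs_mult flip: right_diff_distrib)
    moreover have "\<lfloor>real M * \<tau> h i\<rfloor> = \<lfloor>real M * \<tau> h' i\<rfloor>"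
      using fun_cong[OF hh(3), of i] by (simp add: cell_def)
    ultimately show False by linarith
  qed
  have "(\<Sum>h\<in>H. \<Prod>i\<in>UNIV. (cmod (dirichlet_kernel M (T h i)))\<^sup>2) \<le> (\<Sum>h\<in>H. \<Prod>i\<in>UNIV. w (cell h i))"
  proof (intro sum_mono prod_mono conjI)
    fix h and i :: 'd
    have "\<bar>\<tau> h i\<bar> \<le> 1 / 2"
      using of_int_round_abs_le[of "T h i"] by (simp add: \<tau>_def abs_minus_commute)
    from dirichlet_kernel_cell_bound[OF this, of M]
    show "(cmod (dirichlet_kernel M (T h i)))\<^sup>2 \<le> w (cell h i)"
      by (simp add: \<tau>_def cell_def w_def dirichlet_kernel_shift)
  qed auto
  also have "\<dots> = (\<Sum>c\<in>cell ` H. \<Prod>i\<in>UNIV. w (c i))"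
    using inj by (simp add: sum.reindex)
  also have "\<dots> \<le> (\<Sum>c\<in>(UNIV :: 'd set) \<rightarrow>\<^sub>E J. \<Prod>i\<in>UNIV. w (c i))"
    using J w0 by (intro sum_mono2) (auto simp: J_def finite_PiE intro: prod_nonneg)
  also have "\<dots> = (\<Prod>i\<in>(UNIV :: 'd set). \<Sum>j\<in>J. w j)"
    using J by (subst prod_sum_PiE) auto
  also have "\<dots> = (\<Sum>j\<in>J. w j) ^ CARD('d)" by simp
  also have "\<dots> \<le> ((real M)\<^sup>2 * kernel_constant) ^ CARD('d)"
    using cell_weight_sum_le[OF J] w0
    by (intro power_mono sum_nonneg) (simp_all only: w_def mult_left_mono zero_le_power2 flip: sum_distrib_left)
  finally show ?thesis .
qed

text \<open>Expanding the square and summing over \<open>a\<close> and \<open>b\<close> first turns the coefficient of each pair of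
  frequencies into a product of squared Dirichlet kernels at their difference. These products are
  nonnegative, hence the absolute value may be taken inside, and for each fixed \<open>h\<close> the
  differences \<open>T h - T h'\<close> are again separated. Averaging over differences \<open>a - b\<close> instead of over
  single points is what makes the kernels nonnegative (it amounts to a Fejer weight).\<close>

lemma dual_large_sieve:
  fixes T :: "'h \<Rightarrow> 'd::finite \<Rightarrow> real" and c :: "'h \<Rightarrow> complex"
  assumes H: "finite H" and M: "0 < M" and c: "\<And>h. h \<in> H \<Longrightarrow> cmod (c h) = 1"
    and sep: "\<And>h h' z. h \<in> H \<Longrightarrow> h' \<in> H \<Longrightarrow> h \<noteq> h' \<Longrightarrow>
      \<exists>i. 1 / real M \<le> \<bar>T h i - T h' i - real_of_int (z i)\<bar>"
  shows "(\<Sum>a\<in>index_box M. \<Sum>b\<in>index_box M.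
            (cmod (\<Sum>h\<in>H. c h * unit_char (\<Sum>i\<in>UNIV. (real (a i) - real (b i)) * T h i)))\<^sup>2)
         \<le> real (card H) * ((real M)\<^sup>2 * kernel_constant) ^ CARD('d)" (is "?S \<le> _")
proof -
  define E where "E a h = unit_char (\<Sum>i\<in>UNIV. real (a i) * T h i)" for a :: "'d \<Rightarrow> nat" and h
  define G where "G h h' = (\<Prod>i\<in>UNIV. dirichlet_kernel M (T h i - T h' i))" for h h'
  let ?B = "index_box M :: ('d \<Rightarrow> nat) set"
  have EE: "unit_char (\<Sum>i\<in>UNIV. (real (a i) - real (b i)) * T h i) = E a h * cnj (E b h)" for a b h
    by (simp add: E_def cnj_unit_char left_diff_distrib sum_subtractf flip: unit_char_add)
  have G: "(\<Sum>a\<in>?B. E a h * cnj (E a h')) = G h h'" for h h'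
    unfolding G_def sum_unit_char_index_box[symmetric]
    by (simp add: E_def cnj_unit_char right_diff_distrib sum_subtractf flip: unit_char_add)
  have expand: "complex_of_real ((cmod (\<Sum>h\<in>H. c h * (E a h * cnj (E b h))))\<^sup>2) =
      (\<Sum>h\<in>H. \<Sum>h'\<in>H. c h * cnj (c h') * ((E a h * cnj (E a h')) * cnj (E b h * cnj (E b h'))))" for a b
    unfolding complex_norm_square by (simp add: sum_product mult_ac)
  have "complex_of_real ?S = (\<Sum>a\<in>?B. \<Sum>b\<in>?B. \<Sum>h\<in>H. \<Sum>h'\<in>H.
      c h * cnj (c h') * ((E a h * cnj (E a h')) * cnj (E b h * cnj (E b h'))))"
    unfolding EE of_real_sum expand ..
  also have "\<dots> = (\<Sum>a\<in>?B. \<Sum>h\<in>H. \<Sum>b\<in>?B. \<Sum>h'\<in>H.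
      c h * cnj (c h') * ((E a h * cnj (E a h')) * cnj (E b h * cnj (E b h'))))"
    by (intro sum.cong refl sum.swap)
  also have "\<dots> = (\<Sum>h\<in>H. \<Sum>a\<in>?B. \<Sum>h'\<in>H. \<Sum>b\<in>?B.
      c h * cnj (c h') * ((E a h * cnj (E a h')) * cnj (E b h * cnj (E b h'))))"
    by (subst sum.swap, intro sum.cong refl sum.swap)
  also have "\<dots> = (\<Sum>h\<in>H. \<Sum>h'\<in>H. \<Sum>a\<in>?B. \<Sum>b\<in>?B.
      c h * cnj (c h') * ((E a h * cnj (E a h')) * cnj (E b h * cnj (E b h'))))"
    by (intro sum.cong refl sum.swap)
  also have "\<dots> = (\<Sum>h\<in>H. \<Sum>h'\<in>H. c h * cnj (c h') * (G h h' * cnj (G h h')))"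
    unfolding G[symmetric] cnj_sum sum_product by (simp only: sum_distrib_left)
  finally have S: "complex_of_real ?S = (\<Sum>h\<in>H. \<Sum>h'\<in>H. c h * cnj (c h') * (G h h' * cnj (G h h')))" .
  have "?S = cmod (complex_of_real ?S)"
    by (simp only: norm_of_real) (simp add: sum_nonneg)
  also have "\<dots> \<le> (\<Sum>h\<in>H. \<Sum>h'\<in>H. (cmod (G h h'))\<^sup>2)"
    unfolding S by (intro sum_norm_le) (auto simp: norm_mult c power2_eq_square)
  also have "\<dots> \<le> (\<Sum>h\<in>H. ((real M)\<^sup>2 * kernel_constant) ^ CARD('d))"
  proof (rule sum_mono)
    fix h assume h: "h \<in> H"
    have "(\<Sum>h'\<in>H. (cmod (G h h'))\<^sup>2) =
        (\<Sum>h'\<in>H. \<Prod>i\<in>UNIV. (cmod (dirichlet_kernel M (T h i - T h' i)))\<^sup>2)"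
      by (simp add: G_def flip: prod_norm prod_power_distrib)
    also have "\<dots> \<le> ((real M)\<^sup>2 * kernel_constant) ^ CARD('d)"
    proof (rule separated_kernel_sum[OF H M])
      fix h1 h2 and z :: "'d \<Rightarrow> int" assume "h1 \<in> H" "h2 \<in> H" "h1 \<noteq> h2"
      then obtain i where "1 / real M \<le> \<bar>T h2 i - T h1 i - real_of_int (z i)\<bar>"
        using sep[of h2 h1 z] by auto
      then show "\<exists>i. 1 / real M \<le> \<bar>T h i - T h1 i - (T h i - T h2 i) - real_of_int (z i)\<bar>"
        by (auto intro!: exI[of _ i])
    qed
    finally show "(\<Sum>h'\<in>H. (cmod (G h h'))\<^sup>2) \<le> ((real M)\<^sup>2 * kernel_constant) ^ CARD('d)" .
  qed
  also have "\<dots> = real (card H) * ((real M)\<^sup>2 * kernel_constant) ^ CARD('d)" by simp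
  finally show ?thesis .
qed

section \<open>Counting solutions of the transposed forms\<close>

text \<open>Every integer point of the cube of radius \<open>N\<close> is a difference of two points of the box of side
  \<open>2 N\<close> in at least \<open>N\<close> ways per coordinate, so the Fejer weight dominates a multiple of the
  indicator of the cube.\<close>

lemma differences_cover_cube:
  fixes f :: "('d::finite \<Rightarrow> int) \<Rightarrow> real"
  assumes P: "finite P" "\<And>p i. p \<in> P \<Longrightarrow> \<bar>p i\<bar> \<le> int N" and f: "\<And>p. 0 \<le> f p"
  shows "real (N ^ CARD('d)) * (\<Sum>p\<in>P. f p)
      \<le> (\<Sum>a\<in>index_box (2 * N). \<Sum>b\<in>index_box (2 * N). f (\<lambda>i. int (a i) - int (b i)))"
proof -
  let ?B = "index_box (2 * N) :: ('d \<Rightarrow> nat) set"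
  \<comment> \<open>The representation of \<open>p\<close> as a difference with free parameter \<open>c\<close>: the positive part of \<open>p\<close>
    is added to one copy of \<open>c\<close> and the negative part to the other.\<close>
  define g :: "('d \<Rightarrow> int) \<times> ('d \<Rightarrow> nat) \<Rightarrow> ('d \<Rightarrow> nat) \<times> ('d \<Rightarrow> nat)"
    where "g = (\<lambda>(p, c). (\<lambda>i. c i + nat (p i), \<lambda>i. c i + nat (- p i)))"
  have diff: "(\<lambda>i. int (fst (g x) i) - int (snd (g x) i)) = fst x" for x
    by (auto simp: g_def fun_eq_iff split: prod.splits)
  have inj: "inj_on g (P \<times> index_box N)"
  proof (rule inj_onI)
    fix x y assume xy: "g x = g y"
    then have "fst x = fst y" by (metis diff)
    then show "x = y" using xy by (auto simp: g_def fun_eq_iff split: prod.splits)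
  qed
  have sub: "g ` (P \<times> index_box N) \<subseteq> ?B \<times> ?B"
  proof -
    have "c i + nat (p i) < 2 * N" "c i + nat (- p i) < 2 * N"
      if "p \<in> P" "\<And>i. c i < N" for p c and i :: 'd
      using P(2)[OF that(1), of i] that(2)[of i] by linarith+
    then show ?thesis by (auto simp: g_def index_box_iff)
  qed
  have "real (N ^ CARD('d)) * (\<Sum>p\<in>P. f p) = (\<Sum>x\<in>P \<times> (index_box N :: ('d \<Rightarrow> nat) set). f (fst x))"
    by (simp add: sum.cartesian_product' card_index_box sum_distrib_left)
  also have "\<dots> = (\<Sum>x\<in>P \<times> index_box N. f (\<lambda>i. int (fst (g x) i) - int (snd (g x) i)))"
    by (simp only: diff)
  also have "\<dots> = (\<Sum>x\<in>g ` (P \<times> index_box N). f (\<lambda>i. int (fst x i) - int (snd x i)))"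
    using inj by (simp add: sum.reindex)
  also have "\<dots> \<le> (\<Sum>x\<in>?B \<times> ?B. f (\<lambda>i. int (fst x i) - int (snd x i)))"
    using sub f by (intro sum_mono2) auto
  also have "\<dots> = (\<Sum>a\<in>?B. \<Sum>b\<in>?B. f (\<lambda>i. int (a i) - int (b i)))"
    by (simp add: sum.cartesian_product')
  finally show ?thesis .
qed

text \<open>This is the transference step. A lower bound for the linear forms in \<open>h\<close> given by the rows of
  \<open>\<alpha>\<close> yields an upper bound, of the order predicted by equidistribution, for the number of integer
  points \<open>p\<close> at which the forms given by the columns are close to a prescribed target modulo one.
  Each such \<open>p\<close> makes every term of the exponential sum over \<open>h \<in> [0, K)\<^sup>m\<close> have real part at
  least one half, so the sum has the maximal order \<open>K\<^sup>m\<close> there. The mean square of the sum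
  is much smaller by the large sieve, since the frequencies belonging to different \<open>h\<close> are
  separated.\<close>

lemma card_near_points_le:
  fixes \<alpha> :: "'d::finite \<Rightarrow> 'm::finite \<Rightarrow> real" and \<gamma> :: "'m \<Rightarrow> real"
  assumes N: "0 < N" and K: "0 < K"
    and sep: "\<And>(h :: 'm \<Rightarrow> int) (z :: 'd \<Rightarrow> int). (\<exists>j. h j \<noteq> 0) \<Longrightarrow> (\<And>j. \<bar>h j\<bar> < int K) \<Longrightarrow>
      \<exists>i. 1 / real (2 * N) \<le> \<bar>(\<Sum>j\<in>UNIV. \<alpha> i j * real_of_int (h j)) - real_of_int (z i)\<bar>"
    and P: "finite P" "\<And>p i. p \<in> P \<Longrightarrow> \<bar>p i\<bar> \<le> int N"
    and near: "\<And>p j. p \<in> P \<Longrightarrow>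
      \<exists>k::int. \<bar>(\<Sum>i\<in>UNIV. real_of_int (p i) * \<alpha> i j) - \<gamma> j - real_of_int k\<bar> \<le> 1 / (6 * real CARD('m) * real K)"
  shows "real (card P) * real K ^ CARD('m) \<le> 4 * (4 * kernel_constant) ^ CARD('d) * real N ^ CARD('d)"
proof -
  define H where "H = (index_box K :: ('m \<Rightarrow> nat) set)"
  define T where "T h i = (\<Sum>j\<in>UNIV. \<alpha> i j * real (h j))" for h :: "'m \<Rightarrow> nat" and i
  define c where "c h = unit_char (- (\<Sum>j\<in>UNIV. \<gamma> j * real (h j)))" for h :: "'m \<Rightarrow> nat"
  define f where "f p = (cmod (\<Sum>h\<in>H. c h * unit_char (\<Sum>i\<in>UNIV. real_of_int (p i) * T h i)))\<^sup>2"
    for p :: "'d \<Rightarrow> int"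
  have cardH: "card H = K ^ CARD('m)" by (simp add: H_def card_index_box)
  have lower: "(real K ^ CARD('m))\<^sup>2 / 4 \<le> f p" if p: "p \<in> P" for p
  proof -
    define x where "x j = (\<Sum>i\<in>UNIV. real_of_int (p i) * \<alpha> i j) - \<gamma> j" for j
    obtain k where k: "\<bar>x j - real_of_int (k j)\<bar> \<le> 1 / (6 * real CARD('m) * real K)" for j
      using near[OF p] unfolding x_def by metis
    have eq: "c h * unit_char (\<Sum>i\<in>UNIV. real_of_int (p i) * T h i) = unit_char (\<Sum>j\<in>UNIV. x j * real (h j))" for h
    proof -
      have "(\<Sum>i\<in>UNIV. real_of_int (p i) * T h i) =
          (\<Sum>i\<in>UNIV. \<Sum>j\<in>UNIV. real_of_int (p i) * \<alpha> i j * real (h j))"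
        by (simp add: T_def sum_distrib_left mult.assoc)
      also have "\<dots> = (\<Sum>j\<in>UNIV. (\<Sum>i\<in>UNIV. real_of_int (p i) * \<alpha> i j) * real (h j))"
        unfolding sum_distrib_right by (rule sum.swap)
      finally show ?thesis
        by (simp add: c_def x_def left_diff_distrib sum_subtractf flip: unit_char_add)
    qed
    have re: "1 / 2 \<le> Re (unit_char (\<Sum>j\<in>UNIV. x j * real (h j)))" if h: "h \<in> H" for h
    proof (rule Re_unit_char_ge_half)
      have "\<bar>(\<Sum>j\<in>UNIV. x j * real (h j)) - real_of_int (\<Sum>j\<in>UNIV. k j * int (h j))\<bar>
          = \<bar>\<Sum>j\<in>UNIV. (x j - real_of_int (k j)) * real (h j)\<bar>"
        by (simp add: left_diff_distrib sum_subtractf)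
      also have "\<dots> \<le> (\<Sum>j\<in>UNIV. \<bar>x j - real_of_int (k j)\<bar> * real (h j))"
        by (rule order_trans[OF sum_abs]) (simp add: abs_mult)
      also have "\<dots> \<le> (\<Sum>j\<in>(UNIV::'m set). 1 / (6 * real CARD('m) * real K) * real K)"
        using h k by (intro sum_mono mult_mono) (auto simp: H_def index_box_iff less_imp_le)
      also have "\<dots> = 1 / 6" using K by simp
      finally show "\<bar>(\<Sum>j\<in>UNIV. x j * real (h j)) - real_of_int (\<Sum>j\<in>UNIV. k j * int (h j))\<bar> \<le> 1 / 6" .
    qed
    have "real K ^ CARD('m) / 2 = (\<Sum>h\<in>H. 1 / 2)" by (simp add: cardH)
    also have "\<dots> \<le> Re (\<Sum>h\<in>H. unit_char (\<Sum>j\<in>UNIV. x j * real (h j)))"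
      unfolding Re_sum by (intro sum_mono re)
    also have "\<dots> \<le> cmod (\<Sum>h\<in>H. unit_char (\<Sum>j\<in>UNIV. x j * real (h j)))"
      by (rule complex_Re_le_cmod)
    finally have "(real K ^ CARD('m) / 2)\<^sup>2 \<le> f p"
      unfolding f_def eq by (intro power_mono) auto
    then show ?thesis by (simp add: power_divide)
  qed
  have "real N ^ CARD('d) * (real (card P) * ((real K ^ CARD('m))\<^sup>2 / 4)) \<le> real (N ^ CARD('d)) * (\<Sum>p\<in>P. f p)"
    unfolding of_nat_power
    using sum_mono[of P "\<lambda>_. (real K ^ CARD('m))\<^sup>2 / 4" f] lower by (intro mult_left_mono) auto
  also have "\<dots> \<le> (\<Sum>a\<in>index_box (2 * N). \<Sum>b\<in>index_box (2 * N). f (\<lambda>i. int (a i) - int (b i)))"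
    by (rule differences_cover_cube) (use P in \<open>auto simp: f_def\<close>)
  also have "\<dots> \<le> real (card H) * ((real (2 * N))\<^sup>2 * kernel_constant) ^ CARD('d)"
  proof -
    have "\<exists>i. 1 / real (2 * N) \<le> \<bar>T h i - T h' i - real_of_int (z i)\<bar>"
      if hh: "h \<in> H" "h' \<in> H" "h \<noteq> h'" for h h' and z :: "'d \<Rightarrow> int"
    proof -
      have "\<exists>i. 1 / real (2 * N) \<le> \<bar>(\<Sum>j\<in>UNIV. \<alpha> i j * real_of_int (int (h j) - int (h' j))) - real_of_int (z i)\<bar>"
      proof (rule sep)
        show "\<exists>j. int (h j) - int (h' j) \<noteq> 0" using hh(3) by (auto simp: fun_eq_iff)
        show "\<bar>int (h j) - int (h' j)\<bar> < int K" for j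
          using hh(1,2) unfolding H_def index_box_iff by (smt (verit) of_nat_0_le_iff of_nat_less_iff)
      qed
      then show ?thesis by (simp add: T_def right_diff_distrib sum_subtractf)
    qed
    from dual_large_sieve[where M = "2 * N" and H = H and c = c and T = T, OF _ _ _ this] show ?thesis
      using N by (simp add: f_def H_def c_def)
  qed
  also have "\<dots> = real K ^ CARD('m) * (4 * kernel_constant) ^ CARD('d) * (real N ^ CARD('d))\<^sup>2"
    by (simp add: cardH power_mult_distrib power2_eq_square)
  finally have "(real K ^ CARD('m) * real N ^ CARD('d)) * (real (card P) * real K ^ CARD('m))
      \<le> (real K ^ CARD('m) * real N ^ CARD('d)) * (4 * (4 * kernel_constant) ^ CARD('d) * real N ^ CARD('d))"
    by (simp add: power2_eq_square mult_ac)
  then show ?thesis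
    by (rule mult_left_le_imp_le) (use N K in simp)
qed

section \<open>Diophantine and convergence exponents\<close>

lemma infnorm_attained:
  fixes x :: "real^'n"
  obtains i where "infnorm x = \<bar>x $ i\<bar>"
proof -
  have eq: "infnorm x = Sup (range (\<lambda>i. \<bar>x $ i\<bar>))"
    unfolding infnorm_cart by (simp add: full_SetCompr_eq)
  have "infnorm x = Max (range (\<lambda>i. \<bar>x $ i\<bar>))"
    unfolding eq by (intro cSup_eq_Max) auto
  moreover have "Max (range (\<lambda>i. \<bar>x $ i\<bar>)) \<in> range (\<lambda>i. \<bar>x $ i\<bar>)"
    by (intro Max_in) auto
  ultimately show ?thesis using that by (metis rangeE)
qed

lemma bdd_below_infnorm_image: "bdd_below ((\<lambda>z. infnorm (y - z)) ` Z)"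
  by (rule bdd_belowI2[of _ 0]) (simp add: infnorm_pos_le)

lemma zero_in_int_vectors: "0 \<in> int_vectors"
  by (simp add: int_vectors_def)

lemma dist_int_le: "z \<in> int_vectors \<Longrightarrow> dist_int y \<le> infnorm (y - z)"
  unfolding dist_int_def by (intro cINF_lower bdd_below_infnorm_image)

lemma dist_int_nonneg: "0 \<le> dist_int y"
  unfolding dist_int_def using zero_in_int_vectors by (intro cINF_greatest) (auto simp: infnorm_pos_le)

lemma dist_int_lessE:
  assumes "dist_int y < r"
  obtains z where "z \<in> int_vectors" "infnorm (y - z) < r"
  using assms zero_in_int_vectors unfolding dist_int_def
  by (subst (asm) cINF_less_iff) (auto intro: bdd_below_infnorm_image)

lemma dist_int_le_half:
  fixes y :: "real^'n"
  shows "dist_int y \<le> 1 / 2"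
proof -
  define z :: "real^'n" where "z = (\<chi> i. of_int (round (y $ i)))"
  obtain i where "infnorm (y - z) = \<bar>(y - z) $ i\<bar>" by (rule infnorm_attained)
  also have "\<dots> \<le> 1 / 2"
    using of_int_round_abs_le[of "y $ i"] by (simp add: z_def abs_minus_commute)
  finally have "infnorm (y - z) \<le> 1 / 2" .
  moreover have "dist_int y \<le> infnorm (y - z)"
    by (intro dist_int_le) (simp add: z_def int_vectors_def)
  ultimately show ?thesis by simp
qed

lemma int_vectors_scale: "z \<in> int_vectors \<Longrightarrow> real k *\<^sub>R z \<in> int_vectors"
  by (auto simp: int_vectors_def)

text \<open>The infimum is approximated: an almost nearest integer vector of \<open>y\<close> is multiplied by \<open>k\<close>, and the
  error grows only by this fixed factor.\<close>

lemma dist_int_scale_eq_0: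
  fixes y :: "real^'n"
  assumes "dist_int y = 0"
  shows "dist_int (real k *\<^sub>R y) = 0"
proof (cases "k = 0")
  case True
  then show ?thesis
    using dist_int_le[OF zero_in_int_vectors, of "0 :: real^'n"] dist_int_nonneg[of "0 :: real^'n"]
    by (simp add: infnorm_0)
next
  case False
  have "dist_int (real k *\<^sub>R y) \<le> 0 + e" if "e > 0" for e
  proof -
    obtain z where z: "z \<in> int_vectors" "infnorm (y - z) < e / real k"
      using assms \<open>e > 0\<close> False by (auto intro: dist_int_lessE[of y "e / real k"])
    have "dist_int (real k *\<^sub>R y) \<le> infnorm (real k *\<^sub>R y - real k *\<^sub>R z)"
      by (intro dist_int_le int_vectors_scale z)
    also have "\<dots> = real k * infnorm (y - z)"
      by (simp add: infnorm_mul flip: scaleR_diff_right)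
    also have "\<dots> \<le> e" using z(2) False by (simp add: field_simps)
    finally show ?thesis by simp
  qed
  then have "dist_int (real k *\<^sub>R y) \<le> 0" by (rule field_le_epsilon)
  then show ?thesis using dist_int_nonneg antisym by blast
qed

lemma infinite_multiples:
  fixes h :: "real^'m"
  assumes "h \<noteq> 0"
  shows "infinite (range (\<lambda>k. real (Suc k) *\<^sub>R h))"
  using assms by (intro range_inj_infinite) (auto simp: inj_on_def)

text \<open>The exponent zero is admissible because every point is within one half of the integers.
  Nonnegativity is what keeps the denominator \<open>\<omega> + 1\<close> positive.\<close>

lemma dioph_exponent_nonneg:
  fixes B :: "real^'m^'k"
  assumes "dioph_exponent B = ereal \<omega>"
  shows "0 \<le> \<omega>"
proof -
  have 1: "(vec 1 :: real^'m) \<noteq> 0" by (simp add: vec_eq_iff)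
  have "range (\<lambda>k. real (Suc k) *\<^sub>R (vec 1 :: real^'m))
      \<subseteq> {q \<in> int_vectors. dist_int (B *v q) < infnorm q powr (- 0)}"
  proof (intro subsetI)
    fix q assume "q \<in> range (\<lambda>k. real (Suc k) *\<^sub>R (vec 1 :: real^'m))"
    then obtain k where q: "q = real (Suc k) *\<^sub>R vec 1" by auto
    have "q \<in> int_vectors"
      unfolding q by (intro int_vectors_scale) (simp add: int_vectors_def)
    moreover have "infnorm q \<noteq> 0" using 1 unfolding q by (simp only: infnorm_eq_0) simp
    moreover have "dist_int (B *v q) < 1" using dist_int_le_half[of "B *v q"] by simp
    ultimately show "q \<in> {q \<in> int_vectors. dist_int (B *v q) < infnorm q powr (- 0)}" by simp
  qed
  then have "infinite {q \<in> int_vectors. dist_int (B *v q) < infnorm q powr (- 0)}"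
    using infinite_multiples[OF 1] infinite_super by blast
  then have "ereal 0 \<le> dioph_exponent B"
    unfolding dioph_exponent_def by (intro Sup_upper) blast
  then show ?thesis using assms by simp
qed

text \<open>For an exponent above \<open>\<omega>\<close> only finitely many \<open>h\<close> violate the bound with \<open>c = 1\<close>, and a smaller
  \<open>c\<close> repairs those unless some distance vanishes. It cannot vanish, since then all multiples
  of that \<open>h\<close> would be violations.\<close>

lemma dist_int_lower_bound:
  fixes B :: "real^'m^'k"
  assumes \<omega>: "dioph_exponent B = ereal \<omega>" and less: "\<omega> < \<omega>'"
  obtains c where "0 < c"
    and "\<And>h. h \<in> int_vectors \<Longrightarrow> h \<noteq> 0 \<Longrightarrow> c * infnorm h powr (- \<omega>') \<le> dist_int (B *v h)"
proof -
  define F where "F = {q \<in> int_vectors. dist_int (B *v q) < infnorm q powr (- \<omega>')}"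
  have F: "finite F"
  proof (rule ccontr)
    assume "infinite F"
    then have "ereal \<omega>' \<le> dioph_exponent B"
      unfolding dioph_exponent_def F_def by (intro Sup_upper) blast
    then show False using \<omega> less by simp
  qed
  have pos: "0 < dist_int (B *v h)" if h: "h \<in> int_vectors" "h \<noteq> 0" for h
  proof (rule ccontr)
    assume "\<not> 0 < dist_int (B *v h)"
    then have 0: "dist_int (B *v h) = 0" using dist_int_nonneg[of "B *v h"] by simp
    have "range (\<lambda>k. real (Suc k) *\<^sub>R h) \<subseteq> F"
    proof (intro subsetI)
      fix q assume "q \<in> range (\<lambda>k. real (Suc k) *\<^sub>R h)"
      then obtain k where q: "q = real (Suc k) *\<^sub>R h" by auto
      have "q \<in> int_vectors" unfolding q by (intro int_vectors_scale h)
      moreover have "infnorm q \<noteq> 0" using h unfolding q by (simp only: infnorm_eq_0) simp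
      moreover have "dist_int (B *v q) = 0"
        unfolding q matrix_vector_mult_scaleR by (intro dist_int_scale_eq_0 0)
      ultimately show "q \<in> F" by (simp add: F_def)
    qed
    then show False using infinite_multiples[OF h(2)] F infinite_super by blast
  qed
  define S where "S = insert 1 ((\<lambda>h. dist_int (B *v h) / infnorm h powr (- \<omega>')) ` (F - {0}))"
  have S: "finite S" "S \<noteq> {}" using F by (auto simp: S_def)
  have powr_pos: "0 < infnorm h powr (- \<omega>')" if "h \<noteq> 0" for h :: "real^'m"
    using that by (simp add: infnorm_eq_0)
  have "\<forall>x\<in>S. 0 < x" using pos powr_pos by (auto simp: S_def F_def)
  then have "0 < Min S" using S by simp
  moreover have "Min S * infnorm h powr (- \<omega>') \<le> dist_int (B *v h)"
    if h: "h \<in> int_vectors" "h \<noteq> 0" for h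
  proof (cases "h \<in> F")
    case True
    then have "Min S \<le> dist_int (B *v h) / infnorm h powr (- \<omega>')"
      using h S by (intro Min_le) (auto simp: S_def)
    then show ?thesis using powr_pos[OF h(2)] by (simp add: pos_le_divide_eq)
  next
    case False
    then have "infnorm h powr (- \<omega>') \<le> dist_int (B *v h)" using h by (simp add: F_def)
    moreover have "Min S \<le> 1" using S by (intro Min_le) (auto simp: S_def)
    ultimately show ?thesis
      using mult_right_mono[of "Min S" 1 "infnorm h powr (- \<omega>')"] by simp
  qed
  ultimately show ?thesis using that by blast
qed

lemma finite_large_summands:
  fixes f :: "'a \<Rightarrow> real"
  assumes f: "f summable_on X" "\<And>x. x \<in> X \<Longrightarrow> 0 \<le> f x" and e: "0 < e"
  shows "finite {x \<in> X. e \<le> f x}"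
proof (rule ccontr)
  assume inf: "infinite {x \<in> X. e \<le> f x}"
  obtain n :: nat where n: "infsum f X / e < real n" using reals_Archimedean2 by blast
  obtain Y where Y: "Y \<subseteq> {x \<in> X. e \<le> f x}" "card Y = n" "finite Y"
    using infinite_arbitrarily_large[OF inf, of n] by auto
  have "real n * e \<le> sum f Y"
    using Y sum_mono[of Y "\<lambda>_. e" f] by auto
  also have "\<dots> \<le> infsum f X"
    using Y f by (intro finite_sum_le_infsum) auto
  finally show False using n e by (simp add: field_simps)
qed

lemma conv_exponent_nonneg_and_summable:
  assumes Q: "infinite Q" "Q \<subseteq> {1..}"
  shows "0 \<le> conv_exponent Q"
    and "conv_exponent Q < t \<Longrightarrow> (\<lambda>q. real q powr (- t)) summable_on Q"
proof -
  define V where "V = {\<nu>::real. (\<lambda>q. real q powr (- \<nu>)) summable_on Q}"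
  have lower: "0 \<le> \<nu>" if "\<nu> \<in> V" for \<nu>
  proof (rule ccontr)
    assume "\<not> 0 \<le> \<nu>"
    then have "1 \<le> real q powr (- \<nu>)" if "q \<in> Q" for q
      using that Q by (intro ge_one_powr_ge_zero) auto
    then have "{q \<in> Q. 1 \<le> real q powr (- \<nu>)} = Q" by blast
    moreover have "finite {q \<in> Q. 1 \<le> real q powr (- \<nu>)}"
      using \<open>\<nu> \<in> V\<close> by (intro finite_large_summands) (auto simp: V_def)
    ultimately show False using Q by simp
  qed
  have "summable (\<lambda>q. real q powr (- 2))" by (simp add: summable_real_powr_iff)
  then have "(\<lambda>q. real q powr (- 2)) summable_on UNIV"
    by (intro norm_summable_imp_summable_on) simp
  then have "2 \<in> V" unfolding V_def by (auto intro: summable_on_subset_banach)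
  then have ne: "V \<noteq> {}" by blast
  have eq: "conv_exponent Q = Inf V" by (simp add: conv_exponent_def V_def)
  show "0 \<le> conv_exponent Q" unfolding eq using ne lower by (rule cInf_greatest)
  assume "conv_exponent Q < t"
  then obtain \<nu> where \<nu>: "\<nu> \<in> V" "\<nu> < t"
    unfolding eq using ne by (metis cInf_lessD)
  show "(\<lambda>q. real q powr (- t)) summable_on Q"
  proof (rule summable_on_comparison_test)
    show "(\<lambda>q. real q powr (- \<nu>)) summable_on Q" using \<nu> by (simp add: V_def)
    show "real q powr (- t) \<le> real q powr (- \<nu>)" if "q \<in> Q" for q
      using that \<nu> Q by (intro powr_mono) auto
  qed auto
qed

section \<open>Null sets of Hausdorff measure\<close>

text \<open>Covers arise naturally with index sets such as pairs of a denominator and a numerator. The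
  indices that do not occur in the enumeration contribute the empty set, whose diameter power is
  zero for every exponent.\<close>

lemma hausdorff_content_le_countable_cover:
  fixes U :: "'i::countable \<Rightarrow> 'a::metric_space set"
  assumes cov: "E \<subseteq> (\<Union>i. U i)" and "\<And>i. bounded (U i)" "\<And>i. diameter (U i) \<le> \<delta>" "0 \<le> \<delta>"
  shows "hausdorff_content s \<delta> E \<le> (\<integral>\<^sup>+ i. diam_power s (U i) \<partial>count_space UNIV)"
proof -
  let ?R = "range (to_nat :: 'i \<Rightarrow> nat)"
  define V where "V n = (if n \<in> ?R then U (from_nat n) else {})" for n
  have "E \<subseteq> (\<Union>n. V n)"
    using cov unfolding V_def by fastforce
  moreover have "bounded (V n) \<and> diameter (V n) \<le> \<delta>" for n
    using assms by (auto simp: V_def)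
  ultimately have "hausdorff_content s \<delta> E \<le> (\<Sum>n. diam_power s (V n))"
    unfolding hausdorff_content_def by (intro INF_lower) auto
  also have "\<dots> = (\<integral>\<^sup>+ n. diam_power s (V n) \<partial>count_space UNIV)"
    by (simp add: nn_integral_count_space_nat)
  also have "\<dots> = (\<integral>\<^sup>+ n. diam_power s (V n) \<partial>count_space ?R)"
    by (rule nn_integral_count_space_eq) (auto simp: V_def diam_power_def)
  also have "\<dots> = (\<integral>\<^sup>+ i. diam_power s (V (to_nat i)) \<partial>count_space (UNIV :: 'i set))"
    by (subst nn_integral_bij_count_space[of "to_nat :: 'i \<Rightarrow> nat" UNIV])
      (auto simp: bij_betw_def)
  also have "\<dots> = (\<integral>\<^sup>+ i. diam_power s (U i) \<partial>count_space UNIV)"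
    by (simp add: V_def)
  finally show ?thesis .
qed

lemma hausdorff_measure_eq_0_iff:
  "hausdorff_measure s E = 0 \<longleftrightarrow> (\<forall>\<delta>>0. hausdorff_content s \<delta> E = 0)"
  unfolding hausdorff_measure_def bot_ennreal[symmetric] by (subst SUP_bot_conv) auto

lemma hausdorff_measure_UN_null:
  fixes E :: "nat \<Rightarrow> 'a::metric_space set"
  assumes null: "\<And>R. hausdorff_measure s (E R) = 0"
  shows "hausdorff_measure s (\<Union>R. E R) = 0"
  unfolding hausdorff_measure_eq_0_iff
proof (intro allI impI)
  fix \<delta> :: real assume \<delta>: "\<delta> > 0"
  have "hausdorff_content s \<delta> (\<Union>R. E R) \<le> 0 + ennreal \<epsilon>" if \<epsilon>: "\<epsilon> > 0" for \<epsilon>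
  proof -
    have "\<exists>U. (E R \<subseteq> (\<Union>i::nat. U i) \<and> (\<forall>i. bounded (U i) \<and> diameter (U i) \<le> \<delta>)) \<and>
        (\<Sum>i. diam_power s (U i)) < ennreal (\<epsilon> * (1/2) ^ Suc R)" for R
    proof -
      have "hausdorff_content s \<delta> (E R) < ennreal (\<epsilon> * (1/2) ^ Suc R)"
        using null[of R] \<delta> \<epsilon> by (simp add: hausdorff_measure_eq_0_iff)
      then show ?thesis unfolding hausdorff_content_def INF_less_iff by auto
    qed
    then obtain U where U: "\<And>R. E R \<subseteq> (\<Union>i::nat. U R i)"
      "\<And>R i. bounded (U R i)" "\<And>R i. diameter (U R i) \<le> \<delta>"
      "\<And>R. (\<Sum>i. diam_power s (U R i)) < ennreal (\<epsilon> * (1/2) ^ Suc R)"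
      by metis
    have "hausdorff_content s \<delta> (\<Union>R. E R)
        \<le> (\<integral>\<^sup>+ x. diam_power s (case x of (R, i) \<Rightarrow> U R i) \<partial>count_space UNIV)"
      using U \<delta> by (intro hausdorff_content_le_countable_cover) (fastforce split: prod.splits)+
    also have "\<dots> = (\<integral>\<^sup>+ R. \<integral>\<^sup>+ i. diam_power s (U R i) \<partial>count_space UNIV \<partial>count_space UNIV)"
      by (subst nn_integral_fst_count_space[symmetric]) simp
    also have "\<dots> \<le> (\<Sum>R. ennreal (\<epsilon> * (1/2) ^ Suc R))"
      unfolding nn_integral_count_space_nat using U(4) by (intro suminf_le) (auto intro: less_imp_le)
    also have "\<dots> = ennreal \<epsilon>"
    proof -
      have "(\<lambda>R. \<epsilon> * (1/2) ^ Suc R) sums (\<epsilon> * 1)"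
        by (intro sums_mult power_half_series)
      then show ?thesis using \<epsilon> by (subst suminf_ennreal2) (auto simp: sums_iff)
    qed
    finally show ?thesis by simp
  qed
  then have "hausdorff_content s \<delta> (\<Union>R. E R) \<le> 0"
    by (rule ennreal_le_epsilon)
  then show "hausdorff_content s \<delta> (\<Union>R. E R) = 0" by simp
qed

text \<open>The convergence half of the Borel-Cantelli argument: the tails of the family cover the limsup
  set and have arbitrarily small total weight. All covering sets at level \<open>q\<close> have the same
  positive diameter \<open>d q\<close>, which makes the argument independent of the sign of \<open>s\<close>.\<close>

lemma hausdorff_cantelli:
  fixes B :: "nat \<Rightarrow> 'p::countable \<Rightarrow> 'a::metric_space set"
  assumes fin: "\<And>q. q \<in> Q \<Longrightarrow> finite (P q)"
    and bdd: "\<And>q p. q \<in> Q \<Longrightarrow> p \<in> P q \<Longrightarrow> bounded (B q p)"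
    and diam: "\<And>q p. q \<in> Q \<Longrightarrow> p \<in> P q \<Longrightarrow> diameter (B q p) = d q"
    and pos: "\<And>q. q \<in> Q \<Longrightarrow> 0 < d q"
    and small: "\<And>\<delta>. 0 < \<delta> \<Longrightarrow> finite {q \<in> Q. \<delta> < d q}"
    and summ: "(\<lambda>q. real (card (P q)) * d q powr s) summable_on Q"
    and limsup: "\<And>y. y \<in> E \<Longrightarrow> infinite {q \<in> Q. \<exists>p\<in>P q. y \<in> B q p}"
  shows "hausdorff_measure s E = 0"
  unfolding hausdorff_measure_eq_0_iff
proof (intro allI impI)
  fix \<delta> :: real assume \<delta>: "\<delta> > 0"
  define f where "f q = (if q \<in> Q then real (card (P q)) * d q powr s else 0)" for q
  have f0: "0 \<le> f q" for q by (simp add: f_def)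
  have "f summable_on UNIV"
    using summ by (subst summable_on_cong_neutral[where T = Q and g = "\<lambda>q. real (card (P q)) * d q powr s"])
      (auto simp: f_def)
  then have f: "summable f"
    using f0 by (subst (asm) summable_on_UNIV_nonneg_real_iff) auto
  obtain n0 where n0: "\<And>q. q \<in> Q \<Longrightarrow> n0 \<le> q \<Longrightarrow> d q \<le> \<delta>"
    using small[OF \<delta>] unfolding finite_nat_set_iff_bounded by (auto simp: not_le) (meson not_le)
  have "hausdorff_content s \<delta> E \<le> 0 + ennreal \<epsilon>" if \<epsilon>: "\<epsilon> > 0" for \<epsilon>
  proof -
    obtain n1 where n1: "\<And>n. n1 \<le> n \<Longrightarrow> norm (\<Sum>i. f (i + n)) < \<epsilon>"
      using suminf_exist_split[OF \<epsilon> f] by blast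
    define n where "n = max n0 n1"
    define U where "U x = (if fst x \<in> Q \<and> n \<le> fst x \<and> snd x \<in> P (fst x) then B (fst x) (snd x) else {})" for x
    have "E \<subseteq> (\<Union>x. U x)"
    proof
      fix y assume "y \<in> E"
      then obtain q where "q \<ge> n" "q \<in> Q" "\<exists>p\<in>P q. y \<in> B q p"
        using limsup[of y] unfolding infinite_nat_iff_unbounded_le by blast
      then show "y \<in> (\<Union>x. U x)" by (auto simp: U_def intro!: exI[of _ q])
    qed
    then have "hausdorff_content s \<delta> E \<le> (\<integral>\<^sup>+ x. diam_power s (U x) \<partial>count_space UNIV)"
      using \<delta> bdd diam n0 by (intro hausdorff_content_le_countable_cover) (auto simp: U_def n_def)
    also have "\<dots> = (\<integral>\<^sup>+ q. \<integral>\<^sup>+ p. diam_power s (U (q, p)) \<partial>count_space UNIV \<partial>count_space UNIV)"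
      by (rule nn_integral_fst_count_space[symmetric])
    also have "\<dots> \<le> (\<integral>\<^sup>+ q. ennreal (if n \<le> q then f q else 0) \<partial>count_space UNIV)"
    proof (rule nn_integral_mono)
      fix q
      have "(\<integral>\<^sup>+ p. diam_power s (U (q, p)) \<partial>count_space UNIV)
          \<le> (\<integral>\<^sup>+ p. ennreal (d q powr s) * indicator (P q) p \<partial>count_space UNIV)"
        if "q \<in> Q"
        using diam pos[OF that] that
        by (intro nn_integral_mono) (auto simp: U_def diam_power_def indicator_def)
      also have "\<dots> = ennreal (d q powr s) * of_nat (card (P q))" if "q \<in> Q"
        using fin[OF that] by (simp add: nn_integral_cmult_indicator emeasure_count_space_finite)
      also have "\<dots> = ennreal (f q)" if "q \<in> Q"
        using that by (simp add: f_def ennreal_mult ennreal_of_nat_eq_real_of_nat mult.commute)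
      finally have "q \<in> Q \<Longrightarrow> (\<integral>\<^sup>+ p. diam_power s (U (q, p)) \<partial>count_space UNIV) \<le> ennreal (f q)" .
      moreover have "\<not> (q \<in> Q \<and> n \<le> q) \<Longrightarrow> (\<integral>\<^sup>+ p. diam_power s (U (q, p)) \<partial>count_space UNIV) = 0"
        by (auto simp: U_def diam_power_def)
      ultimately show "(\<integral>\<^sup>+ p. diam_power s (U (q, p)) \<partial>count_space UNIV) \<le> ennreal (if n \<le> q then f q else 0)"
        by (cases "q \<in> Q \<and> n \<le> q") auto
    qed
    also have "\<dots> = (\<Sum>q. ennreal (if n \<le> q then f q else 0))"
      by (rule nn_integral_count_space_nat)
    also have "\<dots> \<le> ennreal \<epsilon>"
    proof -
      define g where "g q = (if n \<le> q then f q else 0)" for q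
      have sg: "summable g"
        by (rule summable_comparison_test'[OF f, of 0]) (auto simp: g_def f0)
      have "suminf g = (\<Sum>i. g (i + n)) + sum g {..<n}"
        by (rule suminf_split_initial_segment[OF sg])
      then have "suminf g = (\<Sum>i. f (i + n))" by (simp add: g_def)
      then have "suminf g \<le> \<epsilon>" using n1[of n] by (simp add: n_def)
      moreover have "(\<Sum>q. ennreal (g q)) = ennreal (suminf g)"
        by (rule suminf_ennreal2[OF _ sg]) (simp add: g_def f0)
      ultimately show ?thesis unfolding g_def by (simp add: ennreal_leI)
    qed
    finally show ?thesis by simp
  qed
  then have "hausdorff_content s \<delta> E \<le> 0"
    by (rule ennreal_le_epsilon)
  then show "hausdorff_content s \<delta> E = 0" by simp
qed

section \<open>Approximable points on the affine subspace\<close>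

definition graph_point :: "real^'m \<Rightarrow> real^'m^'d \<Rightarrow> real^'d \<Rightarrow> real^('d::finite + 'm::finite)" where
  "graph_point \<beta> A' x = vec_append x (\<beta> + x v* A')"

lemma graph_point_simps:
  "graph_point \<beta> A' x $ Inl i = x $ i"
  "graph_point \<beta> A' x $ Inr j = \<beta> $ j + (\<Sum>i\<in>UNIV. x $ i * A' $ i $ j)"
  by (simp_all add: graph_point_def vec_append_def vector_matrix_mult_def mult.commute)

lemma affine_graph_eq: "affine_graph (vec_append (vec \<beta>) A') = range (graph_point \<beta> A')"
proof -
  have "tilde x v* vec_append (vec \<beta>) A' = \<beta> + x v* A'" for x
    by (simp add: vec_eq_iff vector_matrix_mult_def tilde_def vec_append_def UNIV_Plus_UNIV[symmetric]
        sum.Plus del: UNIV_Plus_UNIV)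
  then show ?thesis by (auto simp: affine_graph_def graph_point_def)
qed

definition near_points :: "real^'m^'d \<Rightarrow> ('m \<Rightarrow> real) \<Rightarrow> nat \<Rightarrow> real \<Rightarrow> ('d \<Rightarrow> int) set" where
  "near_points A' \<gamma> N e = {p. (\<forall>i. \<bar>p i\<bar> \<le> int N) \<and>
     (\<forall>j. \<exists>k::int. \<bar>(\<Sum>i\<in>UNIV. real_of_int (p i) * A' $ i $ j) - \<gamma> j - real_of_int k\<bar> \<le> e)}"

lemma finite_near_points: "finite (near_points A' \<gamma> N e)"
proof (rule finite_subset)
  show "near_points A' \<gamma> N e \<subseteq> UNIV \<rightarrow>\<^sub>E {- int N..int N}"
    by (auto simp: near_points_def PiE_def abs_le_iff minus_le_iff)
qed (simp add: finite_PiE)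

text \<open>A Lipschitz constant of the graph map, and of the passage from an error in \<open>q y - \<theta>\<close> to an error
  in \<open>p A'\<close>.\<close>

definition entry_bound :: "real^'m^'d \<Rightarrow> real" where
  "entry_bound A' = 1 + (\<Sum>i\<in>UNIV. \<Sum>j\<in>UNIV. \<bar>A' $ i $ j\<bar>)"

lemma entry_bound_ge_1: "1 \<le> entry_bound A'"
  by (simp add: entry_bound_def sum_nonneg)

lemma combination_le_entry_bound:
  fixes A' :: "real^'m^'d"
  assumes "\<And>i. \<bar>\<epsilon> i\<bar> \<le> r" "0 \<le> r"
  shows "r + \<bar>\<Sum>i\<in>UNIV. \<epsilon> i * A' $ i $ j\<bar> \<le> entry_bound A' * r"
proof -
  have "\<bar>\<Sum>i\<in>UNIV. \<epsilon> i * A' $ i $ j\<bar> \<le> (\<Sum>i\<in>UNIV. r * \<bar>A' $ i $ j\<bar>)"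
    by (rule order_trans[OF sum_abs]) (auto simp: abs_mult intro!: sum_mono mult_right_mono assms)
  also have "\<dots> \<le> (\<Sum>i\<in>UNIV. r * (\<Sum>j\<in>UNIV. \<bar>A' $ i $ j\<bar>))"
    using assms(2) by (intro sum_mono mult_left_mono member_le_sum) auto
  finally show ?thesis by (simp add: entry_bound_def algebra_simps sum_distrib_left)
qed

text \<open>The value modulo one that coordinate \<open>j\<close> of \<open>p A'\<close> has to approximate if the point of the affine
  subspace over \<open>(p + \<theta>) / q\<close> is to be close to a point of \<open>(\<int>\<^sup>n + \<theta>) / q\<close>.\<close>

definition target_shift :: "real^'m \<Rightarrow> real^'m^'d \<Rightarrow> real^('d::finite + 'm::finite) \<Rightarrow> nat \<Rightarrow> 'm \<Rightarrow> real" where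
  "target_shift \<beta> A' \<theta> q j = \<theta> $ Inr j - real q * \<beta> $ j - (\<Sum>i\<in>UNIV. \<theta> $ Inl i * A' $ i $ j)"

definition rational_center ::
    "real^'m \<Rightarrow> real^'m^'d \<Rightarrow> real^('d::finite + 'm::finite) \<Rightarrow> nat \<Rightarrow> ('d \<Rightarrow> int) \<Rightarrow> real^('d + 'm)" where
  "rational_center \<beta> A' \<theta> q p = graph_point \<beta> A' (\<chi> i. (real_of_int (p i) + \<theta> $ Inl i) / real q)"

text \<open>If \<open>y\<close> on the affine subspace is approximated with denominator \<open>q\<close>, then its free coordinates
  determine an integer vector \<open>p\<close>, and substituting \<open>x = (p + \<theta> + \<epsilon>) / q\<close> into the dependent
  coordinates shows that \<open>p A'\<close> is close to its target. The ball is centred on the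
  affine subspace, so that its centre depends on \<open>q\<close> and \<open>p\<close> only.\<close>

lemma approximable_near_rational_center:
  fixes A' :: "real^'m::finite^'d::finite"
  assumes q: "0 < q" and close: "dist_int (real q *\<^sub>R graph_point \<beta> A' x - \<theta>) < r" and r: "r \<le> 1"
    and x: "\<And>i. \<bar>x $ i\<bar> \<le> R" and N: "R + infnorm \<theta> + 1 \<le> real N0"
    and e: "entry_bound A' * r \<le> e"
  shows "\<exists>p\<in>near_points A' (target_shift \<beta> A' \<theta> q) (q * N0) e.
           graph_point \<beta> A' x \<in> cball (rational_center \<beta> A' \<theta> q p) (real CARD('d + 'm) * entry_bound A' * r / real q)"
proof -
  obtain Z where Z: "Z \<in> int_vectors" "infnorm (real q *\<^sub>R graph_point \<beta> A' x - \<theta> - Z) < r"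
    using close by (rule dist_int_lessE)
  have r0: "0 \<le> r" using Z(2) infnorm_pos_le le_less_trans by (metis less_imp_le)
  define \<epsilon> where "\<epsilon> = real q *\<^sub>R graph_point \<beta> A' x - \<theta> - Z"
  have \<epsilon>: "\<bar>\<epsilon> $ i\<bar> \<le> r" for i
    using component_le_infnorm_cart[of \<epsilon> i] Z(2) by (simp add: \<epsilon>_def)
  have "\<forall>i. \<exists>k::int. Z $ i = of_int k" using Z(1) by (auto simp: int_vectors_def elim: Ints_cases)
  then obtain k :: "'d + 'm \<Rightarrow> int" where k: "\<And>i. Z $ i = of_int (k i)" by metis
  define p where "p i = k (Inl i)" for i
  have p: "real_of_int (p i) = real q * x $ i - \<theta> $ Inl i - \<epsilon> $ Inl i" for i
    by (simp add: p_def \<epsilon>_def graph_point_simps flip: k)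
  have comb: "r + \<bar>\<Sum>i\<in>UNIV. \<epsilon> $ Inl i * A' $ i $ j\<bar> \<le> entry_bound A' * r" for j
    using \<epsilon> r0 by (intro combination_le_entry_bound) auto
  have "p \<in> near_points A' (target_shift \<beta> A' \<theta> q) (q * N0) e"
    unfolding near_points_def
  proof (intro CollectI conjI allI)
    fix i
    have "\<bar>real q * x $ i\<bar> \<le> real q * R"
      using x[of i] by (simp add: abs_mult mult_left_mono)
    moreover have "\<bar>\<theta> $ Inl i\<bar> \<le> real q * infnorm \<theta>"
      using component_le_infnorm_cart[of \<theta> "Inl i"] infnorm_pos_le[of \<theta>] q
        mult_right_mono[of 1 "real q" "infnorm \<theta>"] by simp
    moreover have "\<bar>\<epsilon> $ Inl i\<bar> \<le> real q * 1" using \<epsilon>[of "Inl i"] r q by simp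
    ultimately have "\<bar>real_of_int (p i)\<bar> \<le> real q * (R + infnorm \<theta> + 1)"
      unfolding p by (simp add: distrib_left)
    also have "\<dots> \<le> real q * real N0" using N by (intro mult_left_mono) auto
    finally show "\<bar>p i\<bar> \<le> int (q * N0)"
      by (metis of_int_abs of_int_le_iff of_int_of_nat_eq of_nat_mult)
  next
    fix j
    have Zj: "real_of_int (k (Inr j)) = real q * (\<beta> $ j + (\<Sum>i\<in>UNIV. x $ i * A' $ i $ j)) - \<theta> $ Inr j - \<epsilon> $ Inr j"
      by (simp add: \<epsilon>_def graph_point_simps flip: k)
    have "(\<Sum>i\<in>UNIV. real_of_int (p i) * A' $ i $ j) =
        real q * (\<Sum>i\<in>UNIV. x $ i * A' $ i $ j) - (\<Sum>i\<in>UNIV. \<theta> $ Inl i * A' $ i $ j)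
          - (\<Sum>i\<in>UNIV. \<epsilon> $ Inl i * A' $ i $ j)"
      by (simp add: p left_diff_distrib sum_subtractf sum_distrib_left mult.assoc)
    then have "(\<Sum>i\<in>UNIV. real_of_int (p i) * A' $ i $ j) - target_shift \<beta> A' \<theta> q j - real_of_int (k (Inr j))
        = \<epsilon> $ Inr j - (\<Sum>i\<in>UNIV. \<epsilon> $ Inl i * A' $ i $ j)"
      by (simp add: target_shift_def Zj distrib_left)
    moreover have "\<bar>\<epsilon> $ Inr j - (\<Sum>i\<in>UNIV. \<epsilon> $ Inl i * A' $ i $ j)\<bar> \<le> e"
      using \<epsilon>[of "Inr j"] comb[of j] e by linarith
    ultimately show "\<exists>k::int. \<bar>(\<Sum>i\<in>UNIV. real_of_int (p i) * A' $ i $ j) - target_shift \<beta> A' \<theta> q j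
        - real_of_int k\<bar> \<le> e" by (auto intro: exI[of _ "k (Inr j)"])
  qed
  moreover have "graph_point \<beta> A' x \<in> cball (rational_center \<beta> A' \<theta> q p) (real CARD('d + 'm) * entry_bound A' * r / real q)"
  proof -
    let ?D = "graph_point \<beta> A' x - rational_center \<beta> A' \<theta> q p"
    have xi: "x $ i - (real_of_int (p i) + \<theta> $ Inl i) / real q = \<epsilon> $ Inl i / real q" for i
      using q by (simp add: p field_simps)
    have comp: "\<bar>?D $ i\<bar> \<le> entry_bound A' * r / real q" for i
    proof (cases i)
      case (Inl l)
      have "?D $ i = \<epsilon> $ Inl l / real q"
        by (simp add: Inl rational_center_def graph_point_simps xi)
      moreover have "\<bar>\<epsilon> $ Inl l\<bar> \<le> entry_bound A' * r"
        using \<epsilon>[of "Inl l"] mult_right_mono[OF entry_bound_ge_1 r0, of A'] by simp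
      ultimately show ?thesis by (simp add: divide_right_mono)
    next
      case (Inr j)
      have "?D $ i = (\<Sum>l\<in>UNIV. (x $ l - (real_of_int (p l) + \<theta> $ Inl l) / real q) * A' $ l $ j)"
        by (simp add: Inr rational_center_def graph_point_simps left_diff_distrib sum_subtractf)
      also have "\<dots> = (\<Sum>l\<in>UNIV. \<epsilon> $ Inl l * A' $ l $ j) / real q"
        by (simp add: xi sum_divide_distrib)
      finally show ?thesis using comb[of j] r0 by (simp add: divide_right_mono)
    qed
    have "norm ?D \<le> (\<Sum>i\<in>UNIV. \<bar>?D $ i\<bar>)" by (rule norm_le_l1_cart)
    also have "\<dots> \<le> (\<Sum>i\<in>(UNIV::('d + 'm) set). entry_bound A' * r / real q)"
      by (intro sum_mono comp)
    also have "\<dots> = real CARD('d + 'm) * entry_bound A' * r / real q" by simp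
    finally show ?thesis by (simp add: dist_norm norm_minus_commute)
  qed
  ultimately show ?thesis by blast
qed

section \<open>Covering the approximable points\<close>

text \<open>The lower bound on \<open>e\<close> guarantees that every nonzero integer vector \<open>h\<close> of size less than
  \<open>1 / e\<close> has \<open>A' h\<close> at distance at least \<open>1 / q\<close> from the integers, which is the
  separation that the counting lemma asks for.\<close>

lemma card_near_points_bound:
  fixes A' :: "real^'m::finite^'d::finite"
  assumes c: "0 < c" and \<omega>': "0 < \<omega>'"
    and lb: "\<And>h. h \<in> int_vectors \<Longrightarrow> h \<noteq> 0 \<Longrightarrow> c * infnorm h powr (- \<omega>') \<le> dist_int (A' *v h)"
    and q: "0 < q" and N0: "0 < N0"
    and e: "(c * real q) powr (- 1 / \<omega>') \<le> e" "6 * real CARD('m) * e \<le> 1"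
  shows "real (card (near_points A' \<gamma> (q * N0) e))
      \<le> 4 * (4 * kernel_constant) ^ CARD('d) * real (q * N0) ^ CARD('d) * (12 * real CARD('m) * e) ^ CARD('m)"
proof -
  define m where "m = real CARD('m)"
  have m: "1 \<le> m" unfolding m_def by (metis One_nat_def Suc_leI of_nat_1 of_nat_le_iff zero_less_card_finite)
  have "0 < (c * real q) powr (- 1 / \<omega>')" using c q by simp
  then have e0: "0 < e" using e(1) by linarith
  then have me: "0 < 6 * m * e" using m by simp
  define t where "t = 1 / (6 * m * e)"
  \<comment> \<open>\<open>K\<close> is the largest number of frequencies per coordinate that a tolerance \<open>e\<close> permits.\<close>
  define K where "K = nat \<lfloor>t\<rfloor>"
  have t1: "1 \<le> t" using e(2) me by (simp add: t_def m_def)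
  have "1 \<le> \<lfloor>t\<rfloor>" using t1 by simp
  then have K: "0 < K" "real K = of_int \<lfloor>t\<rfloor>" by (auto simp: K_def)
  have K0: "0 < K" by (rule K(1))
  have K_le: "real K \<le> 1 / (6 * m * e)"
    unfolding K(2) t_def by (rule of_int_floor_le)
  have K_ge: "1 / (12 * m * e) \<le> real K"
  proof -
    have "t < real K + 1" unfolding K(2) by linarith
    then have "t / 2 \<le> real K" using K0 by simp
    then show ?thesis by (simp add: t_def)
  qed
  have eK: "e \<le> 1 / (6 * m * real K)"
    using K_le K0 m e0 by (simp add: field_simps)
  have sep: "\<exists>i. 1 / real (2 * (q * N0)) \<le> \<bar>(\<Sum>j\<in>UNIV. A' $ i $ j * real_of_int (h j)) - real_of_int (z i)\<bar>"
    if h: "\<exists>j. h j \<noteq> 0" "\<And>j. \<bar>h j\<bar> < int K" for h :: "'m \<Rightarrow> int" and z :: "'d \<Rightarrow> int"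
  proof -
    define hv :: "real^'m" where "hv = (\<chi> j. of_int (h j))"
    define zv :: "real^'d" where "zv = (\<chi> i. of_int (z i))"
    have hv: "hv \<in> int_vectors" "hv \<noteq> 0" using h(1) by (auto simp: hv_def int_vectors_def vec_eq_iff)
    have zv: "zv \<in> int_vectors" by (simp add: zv_def int_vectors_def)
    have pos: "0 < infnorm hv" using hv(2) by (simp add: infnorm_pos_lt)
    obtain j where j: "infnorm hv = \<bar>hv $ j\<bar>" by (rule infnorm_attained)
    have "infnorm hv \<le> real K" using h(2)[of j] unfolding j by (simp add: hv_def)
    also have "\<dots> \<le> 1 / e"
    proof -
      have "real K * e \<le> real K * (6 * m * e)" using m e0 by (intro mult_left_mono) auto
      also have "\<dots> \<le> 1" using K_le me by (simp add: field_simps)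
      finally show ?thesis using e0 by (simp add: field_simps)
    qed
    finally have "(1 / e) powr (- \<omega>') \<le> infnorm hv powr (- \<omega>')"
      using pos \<omega>' by (intro powr_mono2') auto
    moreover have "(1 / e) powr (- \<omega>') = e powr \<omega>'"
      using e0 by (simp add: powr_minus powr_divide)
    moreover have "((c * real q) powr (- 1 / \<omega>')) powr \<omega>' \<le> e powr \<omega>'"
      using e(1) \<omega>' by (intro powr_mono2) auto
    moreover have "((c * real q) powr (- 1 / \<omega>')) powr \<omega>' = 1 / (c * real q)"
      using c q \<omega>' by (simp add: powr_powr)
    ultimately have "1 / (c * real q) \<le> infnorm hv powr (- \<omega>')" by simp
    then have "c * (1 / (c * real q)) \<le> c * infnorm hv powr (- \<omega>')"
      using c by (intro mult_left_mono) auto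
    also have "\<dots> \<le> dist_int (A' *v hv)" by (rule lb[OF hv])
    also have "\<dots> \<le> infnorm (A' *v hv - zv)" by (rule dist_int_le[OF zv])
    finally have *: "1 / real q \<le> infnorm (A' *v hv - zv)" using c by simp
    obtain i where i: "infnorm (A' *v hv - zv) = \<bar>(A' *v hv - zv) $ i\<bar>" by (rule infnorm_attained)
    have "real q \<le> real (2 * (q * N0))" using N0 by (simp flip: of_nat_mult)
    then have "1 / real (2 * (q * N0)) \<le> 1 / real q"
      using q by (intro divide_left_mono) auto
    then show ?thesis
      using * unfolding i by (intro exI[of _ i]) (simp add: matrix_vector_mult_def hv_def zv_def)
  qed
  let ?P = "near_points A' \<gamma> (q * N0) e"
  have "real (card ?P) * real K ^ CARD('m)
      \<le> 4 * (4 * kernel_constant) ^ CARD('d) * real (q * N0) ^ CARD('d)"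
  proof (rule card_near_points_le[where \<alpha> = "\<lambda>i j. A' $ i $ j" and \<gamma> = \<gamma>])
    show "0 < q * N0" "0 < K" using q N0 K0 by simp_all
    show "finite ?P" by (rule finite_near_points)
    show "\<bar>p i\<bar> \<le> int (q * N0)" if "p \<in> ?P" for p i using that by (simp add: near_points_def)
    show "\<exists>k::int. \<bar>(\<Sum>i\<in>UNIV. real_of_int (p i) * A' $ i $ j) - \<gamma> j - real_of_int k\<bar>
        \<le> 1 / (6 * real CARD('m) * real K)" if "p \<in> ?P" for p j
      using that eK unfolding near_points_def m_def by (blast intro: order_trans)
  qed (rule sep)
  moreover have "1 \<le> real K ^ CARD('m) * (12 * m * e) ^ CARD('m)"
  proof -
    have "1 \<le> real K * (12 * m * e)" using K_ge m e0 by (simp add: field_simps)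
    then show ?thesis by (simp flip: power_mult_distrib)
  qed
  moreover have "0 \<le> (12 * m * e) ^ CARD('m)" using m e0 by simp
  ultimately have "real (card ?P) * 1 \<le> real (card ?P) * (real K ^ CARD('m) * (12 * m * e) ^ CARD('m))"
    and "real (card ?P) * real K ^ CARD('m) * (12 * m * e) ^ CARD('m)
      \<le> 4 * (4 * kernel_constant) ^ CARD('d) * real (q * N0) ^ CARD('d) * (12 * m * e) ^ CARD('m)"
    by (auto intro!: mult_left_mono mult_right_mono simp del: mult_1_right)
  then show ?thesis by (simp only: m_def mult.assoc mult_1_right)
qed

text \<open>The count of centres is controlled for radii of at least \<open>\<rho> q = (c q) powr (-1 / \<omega>')\<close>,
  so \<open>\<psi>\<close> is enlarged to \<open>r = max \<psi> \<rho>\<close>. This costs nothing: the weight of the enlarged cover is of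
  order \<open>r powr (m + s) * q powr (d - s)\<close>, and the part of it that comes from \<open>\<rho>\<close> is a power of \<open>q\<close>
  with exponent \<open>d - s - (m + s) / \<omega>'\<close>, whose sum over \<open>Q\<close> is assumed to converge. The
  restriction to bounded \<open>x\<close> confines the numerators to a cube of side proportional to \<open>q\<close>.\<close>

lemma bounded_part_null:
  fixes A' :: "real^'m::finite^'d::finite" and \<theta> :: "real^('d + 'm)" and s :: real
  assumes Q: "Q \<subseteq> {1..}"
    and c: "0 < c" and \<omega>': "0 < \<omega>'"
    and lb: "\<And>h. h \<in> int_vectors \<Longrightarrow> h \<noteq> 0 \<Longrightarrow> c * infnorm h powr (- \<omega>') \<le> dist_int (A' *v h)"
    and ms: "0 < real CARD('m) + s" and sD: "s \<le> real CARD('d)"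
    and sum\<psi>: "(\<lambda>q. \<psi> q powr (real CARD('m) + s) * real q powr (real CARD('d) - s)) summable_on Q"
    and sumQ: "(\<lambda>q. real q powr (- ((real CARD('m) + s) / \<omega>' - (real CARD('d) - s)))) summable_on Q"
  shows "hausdorff_measure s (approximable_set Q \<psi> \<theta> \<inter> graph_point \<beta> A' ` {x. \<forall>i. \<bar>x $ i\<bar> \<le> R}) = 0"
proof -
  define m D L n where "m = real CARD('m)" and "D = real CARD('d)"
    and "L = entry_bound A'" and "n = real CARD('d + 'm)"
  have m1: "1 \<le> m" and n1: "1 \<le> n"
    unfolding m_def n_def by (metis One_nat_def Suc_leI of_nat_1 of_nat_le_iff zero_less_card_finite)+
  have L1: "1 \<le> L" by (simp add: L_def entry_bound_ge_1)
  have qpos: "0 < q" if "q \<in> Q" for q using that Q by auto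
  define \<rho> where "\<rho> q = (c * real q) powr (- 1 / \<omega>')" for q :: nat
  define r where "r q = max (\<psi> q) (\<rho> q)" for q
  have \<rho>pos: "0 < \<rho> q" if "q \<in> Q" for q using qpos[OF that] c by (simp add: \<rho>_def)
  have rpos: "0 < r q" if "q \<in> Q" for q using \<rho>pos[OF that] by (simp add: r_def less_max_iff_disj)
  define w where "w q = r q powr (m + s) * real q powr (D - s)" for q
  have w: "w summable_on Q"
  proof (rule summable_on_comparison_test)
    define g1 g2 where "g1 q = \<psi> q powr (m + s) * real q powr (D - s)"
      and "g2 q = c powr (- ((m + s) / \<omega>')) * real q powr (- ((m + s) / \<omega>' - (D - s)))" for q :: nat
    show "(\<lambda>q. g1 q + g2 q) summable_on Q"
      unfolding g1_def g2_def using sum\<psi> sumQ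
      by (intro summable_on_add summable_on_cmult_right) (auto simp: m_def D_def)
    fix q assume q: "q \<in> Q"
    have "\<rho> q powr (m + s) * real q powr (D - s) = g2 q"
    proof -
      have "- 1 / \<omega>' * (m + s) = - ((m + s) / \<omega>')" by simp
      then have "\<rho> q powr (m + s) = c powr (- ((m + s) / \<omega>')) * real q powr (- ((m + s) / \<omega>'))"
        by (simp only: \<rho>_def powr_powr powr_mult)
      moreover have "- ((m + s) / \<omega>' - (D - s)) = - ((m + s) / \<omega>') + (D - s)" by simp
      ultimately show ?thesis unfolding g2_def by (simp only: powr_add mult.assoc)
    qed
    moreover have "r q = \<psi> q \<or> r q = \<rho> q" by (simp add: r_def max_def)
    ultimately have "w q = g1 q \<or> w q = g2 q" unfolding w_def g1_def by metis
    moreover have "0 \<le> g1 q" "0 \<le> g2 q" by (simp_all add: g1_def g2_def)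
    ultimately show "w q \<le> g1 q + g2 q" by auto
  qed (simp add: w_def)
  have r_fin: "finite {q \<in> Q. \<delta> \<le> r q}" if \<delta>: "0 < \<delta>" for \<delta>
  proof (rule finite_subset)
    show "{q \<in> Q. \<delta> \<le> r q} \<subseteq> {q \<in> Q. \<delta> powr (m + s) \<le> w q}"
    proof (intro subsetI CollectI conjI)
      fix q assume "q \<in> {q \<in> Q. \<delta> \<le> r q}"
      then have q: "q \<in> Q" "\<delta> \<le> r q" by auto
      have "\<delta> powr (m + s) \<le> r q powr (m + s)"
        using q \<delta> ms by (intro powr_mono2) (auto simp: m_def)
      also have "\<dots> \<le> r q powr (m + s) * real q powr (D - s)"
        using mult_left_mono[of 1 "real q powr (D - s)" "r q powr (m + s)"]
          ge_one_powr_ge_zero[of "real q" "D - s"] qpos[OF q(1)] sD by (simp add: D_def)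
      finally show "\<delta> powr (m + s) \<le> w q" by (simp add: w_def)
    qed auto
    show "finite {q \<in> Q. \<delta> powr (m + s) \<le> w q}"
      using \<delta> by (intro finite_large_summands w) (auto simp: w_def)
  qed
  \<comment> \<open>The counting bound needs a small radius, which excludes only finitely many \<open>q\<close>.\<close>
  define Q0 where "Q0 = {q \<in> Q. r q \<le> 1 / (6 * m * L)}"
  have Q0: "q \<in> Q" "0 < q" "0 < r q" "6 * m * (L * r q) \<le> 1" "r q \<le> 1" if "q \<in> Q0" for q
  proof -
    show q: "q \<in> Q" and "0 < q" "0 < r q" using that qpos rpos by (auto simp: Q0_def)
    have mL: "1 \<le> m * L" using m1 L1 mult_mono[of 1 m 1 L] by simp
    show rq: "6 * m * (L * r q) \<le> 1" using that mL by (simp add: Q0_def field_simps)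
    have "1 * r q \<le> (6 * (m * L)) * r q" using mL \<open>0 < r q\<close> by (intro mult_right_mono) auto
    then show "r q \<le> 1" using rq by (simp add: mult.assoc)
  qed
  have cofinite: "finite (Q - Q0)"
    by (rule finite_subset[OF _ r_fin[of "1 / (6 * m * L)"]]) (use m1 L1 in \<open>auto simp: Q0_def\<close>)
  \<comment> \<open>Numerators satisfy \<open>|p| \<le> q R + |\<theta>| + r \<le> q N0\<close>.\<close>
  obtain N0 :: nat where N0: "max 1 (R + infnorm \<theta> + 1) \<le> real N0" using real_arch_simple by blast
  define P where "P q = near_points A' (target_shift \<beta> A' \<theta> q) (q * N0) (L * r q)" for q
  define B where "B q p = cball (rational_center \<beta> A' \<theta> q p) (n * L * r q / real q)" for q p
  define d where "d q = 2 * (n * L * r q / real q)" for q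
  have rad: "0 < n * L * r q / real q" if "q \<in> Q0" for q
    using Q0[OF that] n1 L1 by simp
  define C where "C = 4 * (4 * kernel_constant) ^ CARD('d) * real N0 ^ CARD('d) * (12 * m * L) ^ CARD('m)
    * (2 * n * L) powr s"
  show ?thesis
  proof (rule hausdorff_cantelli[where Q = Q0 and P = P and B = B and d = d])
    show "finite (P q)" for q by (simp add: P_def finite_near_points)
    show "bounded (B q p)" for q p by (simp add: B_def)
    show "diameter (B q p) = d q" if "q \<in> Q0" for q p
      using rad[OF that] by (simp add: B_def d_def)
    show "0 < d q" if "q \<in> Q0" for q using rad[OF that] by (simp add: d_def)
    show "finite {q \<in> Q0. \<delta> < d q}" if \<delta>: "0 < \<delta>" for \<delta>
    proof (rule finite_subset[OF _ r_fin[of "\<delta> / (2 * n * L)"]])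
      show "{q \<in> Q0. \<delta> < d q} \<subseteq> {q \<in> Q. \<delta> / (2 * n * L) \<le> r q}"
      proof (intro subsetI CollectI conjI)
        fix q assume "q \<in> {q \<in> Q0. \<delta> < d q}"
        then have q: "q \<in> Q0" "\<delta> < d q" by auto
        have "n * L * r q / real q \<le> n * L * r q"
          using Q0(2,3)[OF q(1)] n1 L1 divide_left_mono[of 1 "real q" "n * L * r q"] by simp
        then have "\<delta> \<le> 2 * n * L * r q" using q(2) by (simp add: d_def)
        then show "\<delta> / (2 * n * L) \<le> r q" using n1 L1 by (simp add: field_simps)
      qed (auto simp: Q0_def)
    qed (use \<delta> n1 L1 in simp)
    show "(\<lambda>q. real (card (P q)) * d q powr s) summable_on Q0"
    proof (rule summable_on_comparison_test)
      have "Q0 \<subseteq> Q" by (auto simp: Q0_def)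
      with w show "(\<lambda>q. C * w q) summable_on Q0"
        by (intro summable_on_cmult_right) (rule summable_on_subset_banach)
      fix q assume q: "q \<in> Q0"
      note q' = Q0[OF q]
      have "real (card (P q)) \<le> 4 * (4 * kernel_constant) ^ CARD('d) * real (q * N0) ^ CARD('d)
          * (12 * real CARD('m) * (L * r q)) ^ CARD('m)"
        unfolding P_def
      proof (rule card_near_points_bound[OF c \<omega>' lb q'(2)])
        show "0 < N0" using N0 by simp
        show "6 * real CARD('m) * (L * r q) \<le> 1" using q'(4) by (simp add: m_def)
        have "(c * real q) powr (- 1 / \<omega>') \<le> 1 * r q" by (simp add: r_def \<rho>_def)
        also have "\<dots> \<le> L * r q" using L1 q'(3) by (intro mult_right_mono) auto
        finally show "(c * real q) powr (- 1 / \<omega>') \<le> L * r q" .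
      qed
      then have "real (card (P q)) * d q powr s \<le> 4 * (4 * kernel_constant) ^ CARD('d) * real (q * N0) ^ CARD('d)
          * (12 * m * (L * r q)) ^ CARD('m) * d q powr s"
        by (intro mult_right_mono) (auto simp: m_def)
      also have "\<dots> = C * (r q ^ CARD('m) * r q powr s * (real q ^ CARD('d) * real q powr (- s)))"
      proof -
        have "d q powr s = (2 * n * L) powr s * (r q powr s * real q powr (- s))"
        proof -
          have "d q = (2 * n * L) * (r q / real q)" by (simp add: d_def)
          then have "d q powr s = (2 * n * L) powr s * (r q powr s / real q powr s)"
            by (simp only: powr_mult powr_divide)
          then show ?thesis by (simp only: powr_minus divide_inverse)
        qed
        then show ?thesis by (simp add: C_def power_mult_distrib mult_ac)
      qed
      also have "\<dots> = C * w q"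
        using q'(2,3) by (simp add: w_def m_def D_def powr_add powr_realpow powr_diff powr_minus divide_inverse)
      finally show "real (card (P q)) * d q powr s \<le> C * w q" .
    qed simp
    show "infinite {q \<in> Q0. \<exists>p\<in>P q. y \<in> B q p}"
      if y: "y \<in> approximable_set Q \<psi> \<theta> \<inter> graph_point \<beta> A' ` {x. \<forall>i. \<bar>x $ i\<bar> \<le> R}" for y
    proof -
      obtain x where x: "y = graph_point \<beta> A' x" "\<And>i. \<bar>x $ i\<bar> \<le> R" using y by auto
      have "infinite {q \<in> Q. dist_int (real q *\<^sub>R y - \<theta>) < \<psi> q}"
        using y by (simp add: approximable_set_def)
      then have "infinite ({q \<in> Q. dist_int (real q *\<^sub>R y - \<theta>) < \<psi> q} - (Q - Q0))"
        using cofinite by (intro Diff_infinite_finite)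
      moreover have "{q \<in> Q. dist_int (real q *\<^sub>R y - \<theta>) < \<psi> q} - (Q - Q0) \<subseteq> {q \<in> Q0. \<exists>p\<in>P q. y \<in> B q p}"
      proof
        fix q assume "q \<in> {q \<in> Q. dist_int (real q *\<^sub>R y - \<theta>) < \<psi> q} - (Q - Q0)"
        then have q: "q \<in> Q0" "dist_int (real q *\<^sub>R y - \<theta>) < r q"
          by (auto simp: r_def less_max_iff_disj)
        have "\<exists>p\<in>P q. y \<in> B q p"
          unfolding P_def B_def x(1) n_def L_def
          using Q0[OF q(1)] q(2) x N0
          by (intro approximable_near_rational_center[where R = R]) auto
        then show "q \<in> {q \<in> Q0. \<exists>p\<in>P q. y \<in> B q p}" using q by simp
      qed
      ultimately show ?thesis by (rule infinite_super[rotated])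
    qed
  qed
qed

theorem theorem2p8:
  fixes \<beta> :: "real^'m::finite"
    and A' :: "real^'m^'d::finite"
    and A :: "real^'m^(1 + 'd)"
    and Q :: "nat set"
    and \<nu> \<omega> s :: real
    and \<psi> :: "nat \<Rightarrow> real"
    and \<theta> :: "real^('d + 'm)"
  assumes "A = vec_append (vec \<beta>) A'"
    and "infinite Q" and "Q \<subseteq> {1..}"
    and "conv_exponent Q = \<nu>"
    and "dioph_exponent A' = ereal \<omega>"
    and "ereal \<omega> < (if \<nu> = 0 then \<infinity> else ereal (real CARD('d + 'm) / \<nu>))"
    and "(\<omega> * (real CARD('d) + \<nu>) - real CARD('m)) / (\<omega> + 1) < s"
    and "s \<le> real CARD('d)"
    and "\<And>q. q \<in> Q \<Longrightarrow> 0 \<le> \<psi> q"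
    and "(\<lambda>q. \<psi> q powr (real CARD('m) + s) * real q powr (real CARD('d) - s)) summable_on Q"
  shows "hausdorff_measure s (approximable_set Q \<psi> \<theta> \<inter> affine_graph A) = 0"
proof -
  define m D where "m = real CARD('m)" and "D = real CARD('d)"
  have \<omega>0: "0 \<le> \<omega>" using assms(5) by (rule dioph_exponent_nonneg)
  have \<nu>0: "0 \<le> \<nu>" using conv_exponent_nonneg_and_summable(1)[OF assms(2,3)] assms(4) by simp
  define u where "u = D + \<nu> - s"
  have u0: "0 \<le> u" using assms(8) \<nu>0 by (simp add: u_def D_def)
  have gap: "\<omega> * u < m + s"
    using assms(7) \<omega>0 by (simp add: u_def m_def D_def pos_divide_less_eq algebra_simps)
  \<comment> \<open>The condition on \<open>s\<close> reads \<open>\<omega> u < m + s\<close>. It is open in \<open>\<omega>\<close>, so it leaves room for a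
    slightly larger exponent, for which a uniform lower bound on the linear forms is available.\<close>
  define \<omega>' where "\<omega>' = \<omega> + (m + s - \<omega> * u) / (u + 1)"
  have less: "\<omega> < \<omega>'" using gap u0 by (simp add: \<omega>'_def)
  then have \<omega>'0: "0 < \<omega>'" using \<omega>0 by simp
  have ms: "0 < m + s" using gap mult_nonneg_nonneg[OF \<omega>0 u0] by linarith
  have "\<omega>' * u < m + s"
  proof -
    have "(m + s - \<omega> * u) * u < (m + s - \<omega> * u) * (u + 1)"
      using gap by (intro mult_strict_left_mono) auto
    then have "(m + s - \<omega> * u) / (u + 1) * u < m + s - \<omega> * u"
      using u0 by (simp add: field_simps)
    then show ?thesis by (simp add: \<omega>'_def distrib_right)
  qed
  then have "conv_exponent Q < (m + s) / \<omega>' - (D - s)"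
    using \<omega>'0 unfolding assms(4) u_def by (simp add: field_simps)
  then have sumQ: "(\<lambda>q. real q powr (- ((m + s) / \<omega>' - (D - s)))) summable_on Q"
    by (rule conv_exponent_nonneg_and_summable(2)[OF assms(2,3)])
  obtain c where c: "0 < c"
    "\<And>h. h \<in> int_vectors \<Longrightarrow> h \<noteq> 0 \<Longrightarrow> c * infnorm h powr (- \<omega>') \<le> dist_int (A' *v h)"
    using dist_int_lower_bound[OF assms(5) less] by blast
  have null: "hausdorff_measure s (approximable_set Q \<psi> \<theta> \<inter> graph_point \<beta> A' ` {x. \<forall>i. \<bar>x $ i\<bar> \<le> real R}) = 0"
    for R :: nat
    using bounded_part_null[OF assms(3) c(1) \<omega>'0 c(2) _ assms(8,10), of \<theta> \<beta> "real R"] ms sumQ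
    by (simp add: m_def D_def)
  have "\<exists>R::nat. \<forall>i. \<bar>x $ i\<bar> \<le> real R" for x :: "real^'d"
  proof -
    obtain R :: nat where "infnorm x \<le> real R" using real_arch_simple by blast
    then have "\<bar>x $ i\<bar> \<le> real R" for i
      using component_le_infnorm_cart[of x i] by simp
    then show ?thesis by blast
  qed
  then have "range (graph_point \<beta> A') = (\<Union>R::nat. graph_point \<beta> A' ` {x. \<forall>i. \<bar>x $ i\<bar> \<le> real R})"
    by blast
  then have "approximable_set Q \<psi> \<theta> \<inter> affine_graph A
      = (\<Union>R::nat. approximable_set Q \<psi> \<theta> \<inter> graph_point \<beta> A' ` {x. \<forall>i. \<bar>x $ i\<bar> \<le> real R})"
    unfolding assms(1) affine_graph_eq by (simp only: Int_UN_distrib)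
  then show ?thesis using hausdorff_measure_UN_null[OF null] by simp
qed

end
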